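(* Let $0\le\alpha,\beta<1$ and $n\in\mathbb{N}$. The basis functions of $\mathbf{D}^n_-$ and $\mathbf{D}^n_+$, that is, the $4n$ functions $\varphi_0^-,\dots,\varphi_{n-1}^-,\psi_0^-,\dots,\psi_{n-1}^-,\varphi_0^+,\dots,\varphi_{n-1}^+,\psi_0^+,\dots,\psi_{n-1}^+$, are all linearly independent modulo the minimal domain $\mathcal{D}_{\min}^{\mathbf{J},n}$.
   Context: $\mathbb{N}=\{1,2,\dots\}$. Put $w(x)=(1-x)^\alpha(1+x)^\beta$ and $L^2_{\alpha,\beta}(-1,1)=L^2((-1,1),w\,dx)$. The Jacobi differential expression is $\ell_{\alpha,\beta}[f]=-\frac{1}{w}\left[(1-x)^{\alpha+1}(1+x)^{\beta+1}f'\right]'$, and $\ell^n_{\mathbf{J}}$ denotes its $n$-fold composition with itself. The maximal domain is $$\mathcal{D}_{\max}^{\mathbf{J},n}=\{f\in L^2_{\alpha,\beta}(-1,1): f,f',\dots,f^{(2n-1)}\in AC_{\mathrm{loc}}(-1,1),\ \ell^n_{\mathbf{J}}[f]\in L^2_{\alpha,\beta}(-1,1)\}.$$ For $f,g\in\mathcal{D}_{\max}^{\mathbf{J},n}$ put $[f,g]_n\big|_{-1}^1=\int_{-1}^1(\ell^n_{\mathbf{J}}[f]\overline g-f\,\overline{\ell^n_{\mathbf{J}}[g]})w\,dx$. The minimal domain is $\mathcal{D}_{\min}^{\mathbf{J},n}=\{f\in\mathcal{D}_{\max}^{\mathbf{J},n}:[f,g]_n\big|_{-1}^1=0\ \forall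 g\in\mathcal{D}_{\max}^{\mathbf{J},n}\}$. For $j\in\mathbb{N}_0$ the following are (fixed) functions, smooth on $(-1,1)$: $\varphi_j^+$ equals $(1-x)^j$ for $x$ near $1$ and $0$ for $x$ near $-1$; $\varphi_j^-$ equals $0$ near $1$ and $(1+x)^j$ near $-1$; $\psi_j^+$ equals $(1-x)^{-\alpha+j}$ near $1$ and $0$ near $-1$; $\psi_j^-$ equals $0$ near $1$ and $(1+x)^{-\beta+j}$ near $-1$. Define $$\mathbf{D}^n_\pm=\operatorname{span}\{\varphi_0^\pm,\dots,\varphi_{n-1}^\pm,\psi_0^\pm,\dots,\psi_{n-1}^\pm\}.$$ Vectors $x_1,\dots,x_r$ are linearly independent modulo a subspace $\mathcal{X}_1$ if $\sum_i\alpha_ix_i\in\mathcal{X}_1$ implies all $\alpha_i=0$.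
   Formalization: The formal statement assumes 0<α,β<1 instead of 0≤α,β<1: for α=0 (or β=0) the functions φ_j and ψ_j agree near both endpoints, so their difference has compact support, lies in the minimal domain, and independence fails. *)

theory Defs
  imports "HOL-Analysis.Analysis"
begin

text \<open>
  Elements of the function spaces are represented by functions \<open>real \<Rightarrow> complex\<close> of which only
  the values on the open interval \<open>(-1,1)\<close> matter. Derivatives are two-sided derivatives at points
  of this open interval, so they do not depend on the values outside it. At a point where a function
  is not differentiable, \<^const>\<open>vector_derivative\<close> has an unspecified value; differentiability is
  therefore always required separately where it is needed.
\<close>

definition deriv_iter :: "nat \<Rightarrow> (real \<Rightarrow> complex) \<Rightarrow> real \<Rightarrow> complex"
  where "deriv_iter k f = ((\<lambda>g x. vector_derivative g (at x)) ^^ k) f"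

definition smooth_on_interval :: "(real \<Rightarrow> complex) \<Rightarrow> bool"
  where "smooth_on_interval f \<longleftrightarrow>
    (\<forall>k. \<forall>x\<in>{-1<..<1}. deriv_iter k f differentiable (at x))"

text \<open>
  Finite families of non-overlapping closed subintervals of \<open>[a,b]\<close> are given as divisions (in the
  sense of \<open>division_of\<close>) of subsets of \<open>[a,b]\<close>.
\<close>

definition abs_continuous_on :: "real \<Rightarrow> real \<Rightarrow> (real \<Rightarrow> complex) \<Rightarrow> bool"
  where "abs_continuous_on a b f \<longleftrightarrow>
    (\<forall>\<epsilon>>0. \<exists>\<delta>>0. \<forall>\<D> S. \<D> division_of S \<and> S \<subseteq> {a..b} \<and> (\<Sum>K\<in>\<D>. Sup K - Inf K) < \<delta> \<longrightarrow>
       (\<Sum>K\<in>\<D>. norm (f (Sup K) - f (Inf K))) < \<epsilon>)"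

definition AC_loc :: "(real \<Rightarrow> complex) set"
  where "AC_loc = {f. \<forall>a b. -1 < a \<and> a < b \<and> b < 1 \<longrightarrow> abs_continuous_on a b f}"

definition jacobi_weight :: "real \<Rightarrow> real \<Rightarrow> real \<Rightarrow> real"
  where "jacobi_weight \<alpha> \<beta> x = (1 - x) powr \<alpha> * (1 + x) powr \<beta>"

definition L2_jacobi :: "real \<Rightarrow> real \<Rightarrow> (real \<Rightarrow> complex) set"
  where "L2_jacobi \<alpha> \<beta> = {f. set_borel_measurable lebesgue {-1<..<1} f \<and>
    set_integrable lebesgue {-1<..<1} (\<lambda>x. (norm (f x))\<^sup>2 * jacobi_weight \<alpha> \<beta> x)}"

definition jacobi_expr :: "real \<Rightarrow> real \<Rightarrow> (real \<Rightarrow> complex) \<Rightarrow> real \<Rightarrow> complex"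
  where "jacobi_expr \<alpha> \<beta> f x = - ((1 / jacobi_weight \<alpha> \<beta> x) *\<^sub>R
    vector_derivative
      (\<lambda>t. ((1 - t) powr (\<alpha> + 1) * (1 + t) powr (\<beta> + 1)) *\<^sub>R vector_derivative f (at t)) (at x))"

definition jacobi_power :: "real \<Rightarrow> real \<Rightarrow> nat \<Rightarrow> (real \<Rightarrow> complex) \<Rightarrow> real \<Rightarrow> complex"
  where "jacobi_power \<alpha> \<beta> n f = (jacobi_expr \<alpha> \<beta> ^^ n) f"

text \<open>
  The first condition after membership in \<open>L\<^sup>2\<close> says that \<open>f', \<dots>, f\<^bsup>(2n-1)\<^esup>\<close> exist everywhere on
  \<open>(-1,1)\<close>. The top-order derivative occurring in the \<open>n\<close>-th power of the expression
  then exists almost everywhere, which is enough for the integrals below.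
\<close>

definition D_max :: "real \<Rightarrow> real \<Rightarrow> nat \<Rightarrow> (real \<Rightarrow> complex) set"
  where "D_max \<alpha> \<beta> n = {f \<in> L2_jacobi \<alpha> \<beta>.
    (\<forall>k<2 * n - 1. \<forall>x\<in>{-1<..<1}. deriv_iter k f differentiable (at x)) \<and>
    (\<forall>k<2 * n. deriv_iter k f \<in> AC_loc) \<and>
    jacobi_power \<alpha> \<beta> n f \<in> L2_jacobi \<alpha> \<beta>}"

definition sesqui_form ::
    "real \<Rightarrow> real \<Rightarrow> nat \<Rightarrow> (real \<Rightarrow> complex) \<Rightarrow> (real \<Rightarrow> complex) \<Rightarrow> complex"
  where "sesqui_form \<alpha> \<beta> n f g = set_lebesgue_integral lebesgue {-1<..<1}
    (\<lambda>x. (jacobi_power \<alpha> \<beta> n f x * cnj (g x) - f x * cnj (jacobi_power \<alpha> \<beta> n g x))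
          * complex_of_real (jacobi_weight \<alpha> \<beta> x))"

definition D_min :: "real \<Rightarrow> real \<Rightarrow> nat \<Rightarrow> (real \<Rightarrow> complex) set"
  where "D_min \<alpha> \<beta> n = {f \<in> D_max \<alpha> \<beta> n. \<forall>g\<in>D_max \<alpha> \<beta> n. sesqui_form \<alpha> \<beta> n f g = 0}"

definition boundary_fun_plus :: "real \<Rightarrow> (real \<Rightarrow> complex) \<Rightarrow> bool"
  where "boundary_fun_plus r f \<longleftrightarrow> smooth_on_interval f \<and>
    (\<forall>\<^sub>F x in at_left 1. f x = complex_of_real ((1 - x) powr r)) \<and>
    (\<forall>\<^sub>F x in at_right (-1). f x = 0)"

definition boundary_fun_minus :: "real \<Rightarrow> (real \<Rightarrow> complex) \<Rightarrow> bool"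
  where "boundary_fun_minus r f \<longleftrightarrow> smooth_on_interval f \<and>
    (\<forall>\<^sub>F x in at_left 1. f x = 0) \<and>
    (\<forall>\<^sub>F x in at_right (-1). f x = complex_of_real ((1 + x) powr r))"

definition lin_indep_mod :: "(real \<Rightarrow> complex) set \<Rightarrow> (real \<Rightarrow> complex) list \<Rightarrow> bool"
  where "lin_indep_mod X fs \<longleftrightarrow>
    (\<forall>c :: nat \<Rightarrow> complex. (\<lambda>x. \<Sum>i<length fs. c i * (fs ! i) x) \<in> X \<longrightarrow> (\<forall>i<length fs. c i = 0))"

text \<open>
  The basis functions of \<open>D\<^sub>+\<close> or \<open>D\<^sub>-\<close>. They are kept as a list, so that coinciding entries count
  as linearly dependent. This happens for \<open>\<alpha> = 0\<close>: then \<open>\<phi>\<^sub>j\<close> and \<open>\<psi>\<^sub>j\<close> have the same prescribed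
  values near \<open>1\<close> and near \<open>-1\<close>, and independence modulo the minimal domain fails
  (likewise for \<open>\<beta> = 0\<close>).
\<close>

definition boundary_basis ::
    "nat \<Rightarrow> (nat \<Rightarrow> real \<Rightarrow> complex) \<Rightarrow> (nat \<Rightarrow> real \<Rightarrow> complex) \<Rightarrow> (real \<Rightarrow> complex) list"
  where "boundary_basis n \<phi> \<psi> = map \<phi> [0..<n] @ map \<psi> [0..<n]"

end

theory Submission
  imports Defs
begin

text \<open>
  Near an endpoint, at distance \<open>t\<close> and with weight exponent \<open>\<gamma>\<close> there, a linear combination \<open>F\<close> of
  the basis functions has the form \<open>P(t) + t\<^bsup>-\<gamma>\<^esup> Q(t)\<close> with polynomials \<open>P\<close> and \<open>Q\<close>. The Jacobi
  expression preserves this form, and on monomials it acts by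
  \<open>t\<^bsup>j\<^esup> \<mapsto> -2j(j + \<gamma>) t\<^bsup>j-1\<^esup> + \<dots>\<close> and \<open>t\<^bsup>j-\<gamma>\<^esup> \<mapsto> -2j(j - \<gamma>) t\<^bsup>j-1-\<gamma>\<^esup> + \<dots>\<close>. By the Lagrange identity,
  \<open>[F,g]\<^sub>n\<close> is the sum over \<open>k < n\<close> of the boundary values of the Wronskians of \<open>\<ell>\<^bsup>n-1-k\<^esup>F\<close> and
  \<open>\<ell>\<^bsup>k\<^esup>g\<close>, and such a boundary value is a nonzero multiple of the pairing \<open>P(0) S(0) - Q(0) R(0)\<close>
  (up to conjugation) of the end forms \<open>(P,Q)\<close> and \<open>(R,S)\<close>. If \<open>F\<close> lies in the minimal domain and its
  coefficients of index below \<open>j\<close> vanish, then testing against \<open>\<phi>\<^bsub>n-1-j\<^esub>\<close> and \<open>\<psi>\<^bsub>n-1-j\<^esub>\<close> leaves only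
  the term \<open>k = n-1-j\<close> and forces the coefficients of index \<open>j\<close> to vanish.
\<close>

section \<open>Smooth functions on the interval (-1,1)\<close>

abbreviation vderiv :: "(real \<Rightarrow> complex) \<Rightarrow> real \<Rightarrow> complex"
  where "vderiv f \<equiv> \<lambda>x. vector_derivative f (at x)"

lemma deriv_iter_0: "deriv_iter 0 f = f"
  by (simp add: deriv_iter_def)

lemma deriv_iter_Suc: "deriv_iter (Suc k) f = vderiv (deriv_iter k f)"
  by (simp add: deriv_iter_def)

lemma deriv_iter_Suc': "deriv_iter (Suc k) f = deriv_iter k (vderiv f)"
  by (simp only: deriv_iter_def funpow_Suc_right o_apply)

text \<open>By induction on k, \<open>deriv_iter k f\<close> agrees on (-1,1) with some member of
  \<open>X\<close>; agreement there suffices because derivatives on an open interval are local.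
  Closure properties of smoothness then follow from a suitable invariant, with no formula for higher
  derivatives.\<close>

lemma smooth_on_interval_coinduct:
  assumes "X f"
    and step: "\<And>f. X f \<Longrightarrow> \<exists>f'. X f' \<and> (\<forall>x\<in>{-1<..<1}. (f has_vector_derivative f' x) (at x))"
  shows "smooth_on_interval f"
proof -
  have *: "\<exists>g. X g \<and> (\<forall>x\<in>{-1<..<1}. deriv_iter k f x = g x)" for k
  proof (induction k)
    case 0
    then show ?case using assms(1) by (auto simp: deriv_iter_0)
  next
    case (Suc k)
    then obtain g where g: "X g" "\<forall>x\<in>{-1<..<1}. deriv_iter k f x = g x" by blast
    obtain g' where g': "X g'" "\<forall>x\<in>{-1<..<1}. (g has_vector_derivative g' x) (at x)"
      using step[OF g(1)] by blast
    have "deriv_iter (Suc k) f x = g' x" if x: "x \<in> {-1<..<1}" for x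
    proof -
      have "(deriv_iter k f has_vector_derivative g' x) (at x)"
        by (rule has_vector_derivative_transform_within_open[of g _ _ "{-1<..<1}"])
          (use g(2) bspec[OF g'(2) x] x in simp_all)
      then show ?thesis by (simp add: deriv_iter_Suc vector_derivative_at)
    qed
    then show ?case using g'(1) by blast
  qed
  show ?thesis
    unfolding smooth_on_interval_def
  proof (intro allI ballI)
    fix k x assume x: "x \<in> {-1<..<1::real}"
    obtain g where g: "X g" "\<forall>x\<in>{-1<..<1}. deriv_iter k f x = g x" using * by blast
    obtain g' where g': "X g'" "\<forall>x\<in>{-1<..<1}. (g has_vector_derivative g' x) (at x)"
      using step[OF g(1)] by blast
    have "(deriv_iter k f has_vector_derivative g' x) (at x)"
      by (rule has_vector_derivative_transform_within_open[of g _ _ "{-1<..<1}"])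
        (use g(2) bspec[OF g'(2) x] x in simp_all)
    then show "deriv_iter k f differentiable at x"
      by (rule differentiableI_vector)
  qed
qed

lemma smooth_has_vderiv:
  assumes "smooth_on_interval f" "x \<in> {-1<..<1}"
  shows "(f has_vector_derivative vderiv f x) (at x)"
proof -
  have "deriv_iter 0 f differentiable at x"
    using assms unfolding smooth_on_interval_def by blast
  then show ?thesis
    by (simp add: deriv_iter_0 vector_derivative_works)
qed

lemma smooth_vderiv: "smooth_on_interval f \<Longrightarrow> smooth_on_interval (vderiv f)"
  unfolding smooth_on_interval_def deriv_iter_Suc'[symmetric] by blast

text \<open>The invariant is agreement on (-1,1) with a smooth function; outside this interval the
  values of \<open>g\<close> are arbitrary.\<close>

lemma smooth_cong:
  assumes "smooth_on_interval f" "\<And>x. x \<in> {-1<..<1} \<Longrightarrow> g x = f x"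
  shows "smooth_on_interval g"
proof (rule smooth_on_interval_coinduct[of "\<lambda>h. \<exists>f. smooth_on_interval f \<and> (\<forall>x\<in>{-1<..<1}. h x = f x)"])
  show "\<exists>f. smooth_on_interval f \<and> (\<forall>x\<in>{-1<..<1}. g x = f x)" using assms by blast
next
  fix h assume "\<exists>f. smooth_on_interval f \<and> (\<forall>x\<in>{-1<..<1}. h x = f x)"
  then obtain f where f: "smooth_on_interval f" "\<forall>x\<in>{-1<..<1}. h x = f x" by blast
  have "(h has_vector_derivative vderiv f x) (at x)" if x: "x \<in> {-1<..<1}" for x
    by (rule has_vector_derivative_transform_within_open[of f _ _ "{-1<..<1}"])
      (use f(2) x smooth_has_vderiv[OF f(1) x] in simp_all)
  then show "\<exists>f'. (\<exists>f. smooth_on_interval f \<and> (\<forall>x\<in>{-1<..<1}. f' x = f x)) \<and>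
      (\<forall>x\<in>{-1<..<1}. (h has_vector_derivative f' x) (at x))"
    using smooth_vderiv[OF f(1)] by (intro exI[of _ "vderiv f"]) auto
qed

lemma smooth_add:
  assumes "smooth_on_interval f" "smooth_on_interval g"
  shows "smooth_on_interval (\<lambda>x. f x + g x)"
proof (rule smooth_on_interval_coinduct[of
      "\<lambda>h. \<exists>f g. smooth_on_interval f \<and> smooth_on_interval g \<and> h = (\<lambda>x. f x + g x)"], goal_cases)
  case 1
  then show ?case using assms by blast
next
  case (2 h)
  then obtain f g where *: "smooth_on_interval f" "smooth_on_interval g" "h = (\<lambda>x. f x + g x)"
    by blast
  show ?case
    using has_vector_derivative_add[OF smooth_has_vderiv[OF *(1)] smooth_has_vderiv[OF *(2)]]
      smooth_vderiv[OF *(1)] smooth_vderiv[OF *(2)] unfolding *(3) by blast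
qed

lemma smooth_cmult:
  assumes "smooth_on_interval f"
  shows "smooth_on_interval (\<lambda>x. c * f x)"
proof (rule smooth_on_interval_coinduct[of
      "\<lambda>h. \<exists>f. smooth_on_interval f \<and> h = (\<lambda>x. c * f x)"], goal_cases)
  case 1
  then show ?case using assms by blast
next
  case (2 h)
  then obtain f where *: "smooth_on_interval f" "h = (\<lambda>x. c * f x)"
    by blast
  show ?case
    using has_vector_derivative_mult_right[OF smooth_has_vderiv[OF *(1)], of _ c]
      smooth_vderiv[OF *(1)] unfolding *(2) by blast
qed

lemma smooth_sum:
  assumes "finite A" "\<And>i. i \<in> A \<Longrightarrow> smooth_on_interval (f i)"
  shows "smooth_on_interval (\<lambda>x. \<Sum>i\<in>A. f i x)"
  using assms
proof (induction A rule: finite_induct)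
  case empty
  show ?case
    by (rule smooth_on_interval_coinduct[of "\<lambda>h. h = (\<lambda>x. 0)"]) auto
qed (auto intro: smooth_add)

text \<open>The functions x f alone are not closed under differentiation, since (x f)' = f + x f',
  but the functions g + x f are. With \<open>smooth_add\<close> and \<open>smooth_cmult\<close> this
  gives multiplication by all polynomials.\<close>

lemma smooth_mult_ident:
  assumes "smooth_on_interval f"
  shows "smooth_on_interval (\<lambda>x. of_real x * f x)"
proof (rule smooth_on_interval_coinduct[of
      "\<lambda>h. \<exists>f g. smooth_on_interval f \<and> smooth_on_interval g \<and> h = (\<lambda>x. g x + of_real x * f x)"], goal_cases)
  case 1
  \<comment> \<open>The zero function is an empty sum, so the summands may be
    \<open>undefined\<close>.\<close>
  have "smooth_on_interval (\<lambda>x. 0)"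
    using smooth_sum[of "{}::nat set" undefined] by simp
  then show ?case using assms by (intro exI[of _ f] exI[of _ "\<lambda>x. 0"]) auto
next
  case (2 h)
  then obtain f g where *: "smooth_on_interval f" "smooth_on_interval g"
      "h = (\<lambda>x. g x + of_real x * f x)"
    by blast
  have "(h has_vector_derivative (f x + vderiv g x) + of_real x * vderiv f x) (at x)"
    if "x \<in> {-1<..<1}" for x
    unfolding *(3) using smooth_has_vderiv[OF *(1) that] smooth_has_vderiv[OF *(2) that]
    by (auto intro!: derivative_eq_intros)
  moreover have "smooth_on_interval (\<lambda>x. f x + vderiv g x)"
    using * by (intro smooth_add smooth_vderiv)
  ultimately show ?case
    using smooth_vderiv[OF *(1)]
    by (intro exI[of _ "\<lambda>x. (f x + vderiv g x) + of_real x * vderiv f x"] conjI ballI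
        exI[of _ "vderiv f"] exI[of _ "\<lambda>x. f x + vderiv g x"]) auto
qed

lemma smooth_continuous_on:
  "smooth_on_interval f \<Longrightarrow> continuous_on {-1<..<1} f"
  by (auto intro!: continuous_at_imp_continuous_on has_vector_derivative_continuous[OF smooth_has_vderiv])

text \<open>The continuous derivative is bounded on [a,b] by some C, so f is Lipschitz there and
  \<delta> = \<epsilon> / C works for every finite family of intervals.\<close>

lemma smooth_imp_AC_loc:
  assumes "smooth_on_interval f"
  shows "f \<in> AC_loc"
  unfolding AC_loc_def mem_Collect_eq
proof (intro allI impI)
  fix a b :: real assume ab: "-1 < a \<and> a < b \<and> b < 1"
  have "continuous_on {a..b} (vderiv f)"
    by (rule continuous_on_subset[OF smooth_continuous_on[OF smooth_vderiv[OF assms]]]) (use ab in auto)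
  then have "bounded (vderiv f ` {a..b})"
    by (intro compact_imp_bounded compact_continuous_image) auto
  then obtain C where "C > 0" "\<forall>y\<in>vderiv f ` {a..b}. norm y \<le> C"
    unfolding bounded_pos by (elim exE conjE)
  then have C: "C > 0" "\<And>x. x \<in> {a..b} \<Longrightarrow> norm (vderiv f x) \<le> C"
    by simp_all
  have lip: "norm (f x - f y) \<le> C * norm (x - y)" if "x \<in> {a..b}" "y \<in> {a..b}" for x y
  proof (rule differentiable_bound[of "{a..b}" f "\<lambda>x h. h *\<^sub>R vderiv f x"])
    show "(f has_derivative (\<lambda>h. h *\<^sub>R vderiv f x)) (at x within {a..b})" if "x \<in> {a..b}" for x
      using smooth_has_vderiv[OF assms, of x] that ab
      by (auto simp: has_vector_derivative_def intro: has_derivative_at_withinI[of _ _ x])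
    show "onorm (\<lambda>h. h *\<^sub>R vderiv f x) \<le> C" if "x \<in> {a..b}" for x
      using C(2)[OF that] by (intro onorm_le) (simp add: mult.commute[of C] mult_left_mono)
  qed (use that in auto)
  show "abs_continuous_on a b f"
    unfolding abs_continuous_on_def
  proof (intro allI impI)
    fix \<epsilon> :: real assume \<epsilon>: "0 < \<epsilon>"
    show "\<exists>\<delta>>0. \<forall>\<D> S. \<D> division_of S \<and> S \<subseteq> {a..b} \<and> (\<Sum>K\<in>\<D>. Sup K - Inf K) < \<delta> \<longrightarrow>
       (\<Sum>K\<in>\<D>. norm (f (Sup K) - f (Inf K))) < \<epsilon>"
    proof (intro exI[of _ "\<epsilon> / C"] conjI allI impI)
      fix \<D> S assume *: "\<D> division_of S \<and> S \<subseteq> {a..b} \<and> (\<Sum>K\<in>\<D>. Sup K - Inf K) < \<epsilon> / C"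
      have "norm (f (Sup K) - f (Inf K)) \<le> C * (Sup K - Inf K)" if "K \<in> \<D>" for K
      proof -
        note div = conjunct1[OF *]
        have K: "K \<noteq> {}" "K \<subseteq> {a..b}"
          using division_ofD(2,3)[OF div that] * by (simp, blast)
        have "\<exists>u v. K = cbox u v" by (rule division_ofD(4)[OF div that])
        then obtain u v where "K = cbox u v" by blast
        then have uv: "K = {u..v}" by simp
        with K(1) have "u \<le> v" by simp
        then have "Sup K = v" "Inf K = u" unfolding uv by simp_all
        moreover have "u \<in> {a..b}" "v \<in> {a..b}"
          using K(2) \<open>u \<le> v\<close> unfolding uv by (simp_all add: subset_iff)
        ultimately show ?thesis using lip[of v u] \<open>u \<le> v\<close> by simp
      qed
      then have "(\<Sum>K\<in>\<D>. norm (f (Sup K) - f (Inf K))) \<le> (\<Sum>K\<in>\<D>. C * (Sup K - Inf K))"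
        by (rule sum_mono)
      also have "\<dots> < \<epsilon>"
        using * C(1) by (simp flip: sum_distrib_left add: pos_less_divide_eq mult.commute)
      finally show "(\<Sum>K\<in>\<D>. norm (f (Sup K) - f (Inf K))) < \<epsilon>" .
    qed (use \<epsilon> C in auto)
  qed
qed

lemma smooth_deriv_iter: "smooth_on_interval f \<Longrightarrow> smooth_on_interval (deriv_iter k f)"
  by (induction k) (auto simp: deriv_iter_0 deriv_iter_Suc intro: smooth_vderiv)

section \<open>Integrability at the endpoints\<close>

lemma has_real_derivative_powr_affine:
  fixes \<sigma> x r :: real
  assumes "1 - \<sigma> * x > 0"
  shows "((\<lambda>x. (1 - \<sigma> * x) powr r) has_real_derivative - \<sigma> * r * (1 - \<sigma> * x) powr (r - 1)) (at x)"
proof -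
  have "((\<lambda>x. 1 - \<sigma> * x) has_real_derivative - \<sigma>) (at x)"
    by (auto intro!: derivative_eq_intros)
  from DERIV_chain2[OF has_real_derivative_powr[OF assms, of r] this] show ?thesis
    by (simp add: mult_ac)
qed

text \<open>With t = 1 - \<sigma> x, the antiderivative -\<sigma> t^(1-\<gamma>) / (1-\<gamma>) is
  continuous up to the endpoint because \<gamma> < 1. The integrand is nonnegative, so its gauge
  integral on [-1,1] yields absolute integrability.\<close>

lemma powr_integrable_endpoint:
  fixes \<sigma> \<gamma> :: real
  assumes "\<sigma> = 1 \<or> \<sigma> = -1" "\<gamma> < 1"
  shows "set_integrable lebesgue {-1<..<1} (\<lambda>x. (1 - \<sigma> * x) powr (-\<gamma>))"
proof -
  have "((\<lambda>x. (1 - \<sigma> * x) powr (-\<gamma>)) has_integral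
      (- \<sigma> * (1 - \<sigma> * 1) powr (1 - \<gamma>) / (1 - \<gamma>)) - (- \<sigma> * (1 - \<sigma> * (-1)) powr (1 - \<gamma>) / (1 - \<gamma>))) {-1..1}"
  proof (rule fundamental_theorem_of_calculus_interior)
    show "continuous_on {-1..1} (\<lambda>x. - \<sigma> * (1 - \<sigma> * x) powr (1 - \<gamma>) / (1 - \<gamma>))"
      using assms by (auto intro!: continuous_intros continuous_on_powr')
    show "((\<lambda>x. - \<sigma> * (1 - \<sigma> * x) powr (1 - \<gamma>) / (1 - \<gamma>)) has_vector_derivative
        (1 - \<sigma> * x) powr (-\<gamma>)) (at x)" if "x \<in> {-1<..<1}" for x
    proof -
      have "1 - \<sigma> * x > 0" using assms(1) that by auto
      from has_real_derivative_powr_affine[OF this, of "1 - \<gamma>"]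
      have "((\<lambda>x. (- \<sigma> / (1 - \<gamma>)) * (1 - \<sigma> * x) powr (1 - \<gamma>)) has_real_derivative
          (- \<sigma> / (1 - \<gamma>)) * (- \<sigma> * (1 - \<gamma>) * (1 - \<sigma> * x) powr (1 - \<gamma> - 1))) (at x)"
        by (rule DERIV_cmult)
      moreover have "\<sigma> * \<sigma> = 1" using assms(1) by auto
      then have "(- \<sigma> / (1 - \<gamma>)) * (- \<sigma> * (1 - \<gamma>) * (1 - \<sigma> * x) powr (1 - \<gamma> - 1)) = (1 - \<sigma> * x) powr (-\<gamma>)"
        using assms(2) by (simp flip: mult.assoc)
      ultimately show ?thesis
        by (simp add: has_real_derivative_iff_has_vector_derivative)
    qed
  qed auto
  then have "(\<lambda>x. (1 - \<sigma> * x) powr (-\<gamma>)) absolutely_integrable_on {-1..1}"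
    by (intro nonnegative_absolutely_integrable_1) (auto simp: has_integral_integrable)
  then show ?thesis
    by (rule set_integrable_subset) auto
qed

lemma set_borel_measurable_open_continuous:
  fixes f :: "real \<Rightarrow> 'a::{real_normed_vector,second_countable_topology}"
  assumes "continuous_on {-1<..<1} f"
  shows "set_borel_measurable lebesgue {-1<..<1} f"
  using borel_measurable_continuous_on_indicator[OF _ assms]
  by (simp add: set_borel_measurable_def measurable_completion)

text \<open>The function h is dominated by the two endpoint powers plus a constant M that bounds it
  on the compact part in between.\<close>

lemma set_integrable_endpoint_bounds:
  fixes h :: "real \<Rightarrow> real"
  assumes "continuous_on {-1<..<1} h" "\<alpha> < 1" "\<beta> < 1"
    and "e > 0" "\<And>x. x \<in> {-1<..<1} \<Longrightarrow> 1 - x < e \<Longrightarrow> \<bar>h x\<bar> \<le> C * (1 - x) powr (-\<alpha>)"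
    and "d > 0" "\<And>x. x \<in> {-1<..<1} \<Longrightarrow> 1 + x < d \<Longrightarrow> \<bar>h x\<bar> \<le> B * (1 + x) powr (-\<beta>)"
  shows "set_integrable lebesgue {-1<..<1} h"
proof -
  have "compact (h ` {-1 + d .. 1 - e})"
    by (intro compact_continuous_image continuous_on_subset[OF assms(1)])
      (use assms in auto)
  then have "bounded (h ` {-1 + d .. 1 - e})" by (rule compact_imp_bounded)
  then obtain M where "M > 0" "\<forall>y\<in>h ` {-1 + d .. 1 - e}. norm y \<le> M"
    unfolding bounded_pos by (elim exE conjE)
  then have M: "M > 0" "\<And>x. x \<in> {-1 + d .. 1 - e} \<Longrightarrow> \<bar>h x\<bar> \<le> M"
    by simp_all
  show ?thesis
  proof (rule set_integrable_bound)
    \<comment> \<open>The constant is written as \<open>M * (1 - 1 * x) powr - 0\<close>, so that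
      \<open>powr_integrable_endpoint\<close> covers all three summands.\<close>
    show "set_integrable lebesgue {-1<..<1}
        (\<lambda>x. \<bar>C\<bar> * (1 - 1 * x) powr (-\<alpha>) + (\<bar>B\<bar> * (1 - (-1) * x) powr (-\<beta>) + M * (1 - 1 * x) powr - 0))"
      by (intro set_integral_add set_integrable_mult_right powr_integrable_endpoint) (use assms in auto)
    show "set_borel_measurable lebesgue {-1<..<1} h"
      by (intro set_borel_measurable_open_continuous assms)
    show "AE x in lebesgue. x \<in> {-1<..<1} \<longrightarrow> norm (h x) \<le> norm
        (\<bar>C\<bar> * (1 - 1 * x) powr (-\<alpha>) + (\<bar>B\<bar> * (1 - (-1) * x) powr (-\<beta>) + M * (1 - 1 * x) powr - 0))"
    proof (intro AE_I2 impI)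
      fix x :: real assume x: "x \<in> {-1<..<1}"
      have "C * (1 - x) powr (-\<alpha>) \<le> \<bar>C\<bar> * (1 - x) powr (-\<alpha>)"
        "B * (1 + x) powr (-\<beta>) \<le> \<bar>B\<bar> * (1 + x) powr (-\<beta>)" by (auto intro: mult_right_mono)
      moreover have "0 \<le> \<bar>C\<bar> * (1 - x) powr (-\<alpha>)" "0 \<le> \<bar>B\<bar> * (1 + x) powr (-\<beta>)" by auto
      moreover have "1 - x < e \<or> 1 + x < d \<or> x \<in> {-1 + d .. 1 - e}" by auto
      then have "\<bar>h x\<bar> \<le> C * (1 - x) powr (-\<alpha>) \<or> \<bar>h x\<bar> \<le> B * (1 + x) powr (-\<beta>) \<or> \<bar>h x\<bar> \<le> M"
        using assms(5)[OF x] assms(7)[OF x] M(2) by blast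
      ultimately have "\<bar>h x\<bar> \<le> \<bar>C\<bar> * (1 - x) powr (-\<alpha>) + (\<bar>B\<bar> * (1 + x) powr (-\<beta>) + M)"
        using M(1) by argo
      then show "norm (h x) \<le> norm (\<bar>C\<bar> * (1 - 1 * x) powr (-\<alpha>) + (\<bar>B\<bar> * (1 - (-1) * x) powr (-\<beta>) + M * (1 - 1 * x) powr - 0))"
        using x by simp
    qed
  qed
qed

section \<open>The Jacobi expression on smooth functions\<close>

lemma jacobi_weight_pos: "x \<in> {-1<..<1} \<Longrightarrow> jacobi_weight \<alpha> \<beta> x > 0"
  by (simp add: jacobi_weight_def)

lemma continuous_on_jacobi_weight: "continuous_on {-1<..<1} (jacobi_weight \<alpha> \<beta>)"
  unfolding jacobi_weight_def by (auto intro!: continuous_intros)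

text \<open>The leading coefficient is w (1 - x^2), and its derivative is w times an affine
  function. The weight w therefore factors out and cancels in \<open>jacobi_expr\<close>, which
  becomes a second-order operator with polynomial coefficients.\<close>

lemma jacobi_leading_deriv:
  assumes "smooth_on_interval f" "x \<in> {-1<..<1}"
  shows "((\<lambda>t. ((1 - t) powr (\<alpha> + 1) * (1 + t) powr (\<beta> + 1)) *\<^sub>R vderiv f t) has_vector_derivative
    jacobi_weight \<alpha> \<beta> x *\<^sub>R ((1 - x\<^sup>2) *\<^sub>R vderiv (vderiv f) x + (\<beta> - \<alpha> - (\<alpha> + \<beta> + 2) * x) *\<^sub>R vderiv f x)) (at x)"
proof -
  have x: "1 - x > 0" "1 + x > 0" using assms(2) by auto
  have "((\<lambda>t. (1 - t) powr (\<alpha> + 1) * (1 + t) powr (\<beta> + 1)) has_real_derivative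
      jacobi_weight \<alpha> \<beta> x * (\<beta> - \<alpha> - (\<alpha> + \<beta> + 2) * x)) (at x)"
    using DERIV_mult[OF has_real_derivative_powr_affine[of 1 x "\<alpha> + 1"]
        has_real_derivative_powr_affine[of "-1" x "\<beta> + 1"]] x
    by (simp add: jacobi_weight_def powr_add algebra_simps)
  moreover have "(1 - x) powr (\<alpha> + 1) * (1 + x) powr (\<beta> + 1) = jacobi_weight \<alpha> \<beta> x * (1 - x\<^sup>2)"
    using x by (simp add: jacobi_weight_def powr_add power2_eq_square algebra_simps)
  ultimately show ?thesis
    using has_vector_derivative_scaleR[OF _ smooth_has_vderiv[OF smooth_vderiv[OF assms(1)] assms(2)]]
    by (fastforce simp: scaleR_add_right)
qed

lemma jacobi_expr_explicit:
  assumes "smooth_on_interval f" "x \<in> {-1<..<1}"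
  shows "jacobi_expr \<alpha> \<beta> f x =
    - ((1 - x\<^sup>2) *\<^sub>R vderiv (vderiv f) x + (\<beta> - \<alpha> - (\<alpha> + \<beta> + 2) * x) *\<^sub>R vderiv f x)"
  using vector_derivative_at[OF jacobi_leading_deriv[OF assms, of \<alpha> \<beta>]] jacobi_weight_pos[OF assms(2), of \<alpha> \<beta>]
  by (simp add: jacobi_expr_def)

lemma smooth_jacobi_expr:
  assumes "smooth_on_interval f"
  shows "smooth_on_interval (jacobi_expr \<alpha> \<beta> f)"
proof -
  let ?g = "vderiv f" and ?h = "vderiv (vderiv f)"
  have s: "smooth_on_interval ?g" "smooth_on_interval ?h"
    using assms by (auto intro: smooth_vderiv)
  have "smooth_on_interval (\<lambda>x. (-1) * ?h x + (of_real x * (of_real x * ?h x) +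
      (of_real (\<alpha> - \<beta>) * ?g x + of_real (\<alpha> + \<beta> + 2) * (of_real x * ?g x))))"
    by (intro smooth_add smooth_cmult smooth_mult_ident s)
  then show ?thesis
    by (rule smooth_cong)
      (simp add: jacobi_expr_explicit[OF assms] scaleR_conv_of_real power2_eq_square algebra_simps)
qed

lemma smooth_jacobi_power:
  "smooth_on_interval f \<Longrightarrow> smooth_on_interval (jacobi_power \<alpha> \<beta> k f)"
  by (induction k) (auto simp: jacobi_power_def intro: smooth_jacobi_expr)

section \<open>Expansions at an endpoint\<close>

text \<open>
  Here \<open>1 - \<sigma> * x\<close> is the distance \<open>t\<close> of \<open>x\<close> to the endpoint \<open>\<sigma> = \<plusminus>1\<close>, and an end term is \<open>t\<^bsup>-c\<^esup> P(t)\<close>.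
\<close>
definition end_term :: "real \<Rightarrow> real \<Rightarrow> complex poly \<Rightarrow> real \<Rightarrow> complex"
  where "end_term \<sigma> c P x = of_real ((1 - \<sigma> * x) powr (-c)) * poly P (of_real (1 - \<sigma> * x))"

text \<open>The x-derivative of t^(-c) P(t) is t^(-c-1) times this polynomial; the factor -\<sigma>
  is dt/dx. Lowering the power of t keeps the derivative a single end term.\<close>

definition end_deriv :: "real \<Rightarrow> real \<Rightarrow> complex poly \<Rightarrow> complex poly"
  where "end_deriv \<sigma> c P = smult (of_real (-\<sigma>)) ([:0, 1:] * pderiv P - smult (of_real c) P)"

lemma has_vector_derivative_end_term:
  assumes "1 - \<sigma> * x > 0"
  shows "(end_term \<sigma> c P has_vector_derivative end_term \<sigma> (c + 1) (end_deriv \<sigma> c P) x) (at x)"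
proof -
  define t where "t = 1 - \<sigma> * x"
  have 1: "((\<lambda>x. (1 - \<sigma> * x) powr (-c)) has_real_derivative - \<sigma> * (-c) * t powr (-c - 1)) (at x)"
    unfolding t_def by (rule has_real_derivative_powr_affine[OF assms])
  have "((\<lambda>x. complex_of_real (1 - \<sigma> * x)) has_vector_derivative of_real (-\<sigma>)) (at x)"
    by (auto intro!: derivative_eq_intros simp: has_vector_derivative_def scaleR_conv_of_real)
  from field_vector_diff_chain_at[OF this poly_DERIV, of P]
  have 2: "((\<lambda>x. poly P (of_real (1 - \<sigma> * x))) has_vector_derivative
      of_real (-\<sigma>) * poly (pderiv P) (of_real t)) (at x)"
    by (simp add: o_def t_def)
  have eq: "t powr (-c) = t * t powr (-c - 1)"
    using assms by (simp add: powr_diff t_def)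
  have exponent: "- 1 - c = - c - 1" by simp
  show ?thesis
    using has_vector_derivative_scaleR[OF 1 2]
    unfolding end_term_def scaleR_conv_of_real t_def[symmetric]
    by (rule has_vector_derivative_eq_rhs) (simp add: end_deriv_def eq exponent algebra_simps)
qed

text \<open>Near the end \<sigma> the identity f = P(t) + t^(-\<gamma>) Q(t) holds exactly. The
  powers 0 and -\<gamma> are the indicial exponents of the Jacobi expression at that end.\<close>

definition end_form :: "real \<Rightarrow> real \<Rightarrow> (real \<Rightarrow> complex) \<Rightarrow> complex poly \<Rightarrow> complex poly \<Rightarrow> bool"
  where "end_form \<sigma> \<gamma> f P Q \<longleftrightarrow>
    (\<exists>e>0. \<forall>x\<in>{-1<..<1}. 1 - \<sigma> * x < e \<longrightarrow> f x = end_term \<sigma> 0 P x + end_term \<sigma> \<gamma> Q x)"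

text \<open>The exponents c and d are arbitrary so that the lemma can be applied to its own result,
  which yields the second derivative.\<close>

lemma vderiv_end_terms:
  assumes "\<sigma> = 1 \<or> \<sigma> = -1"
    and "\<forall>x\<in>{-1<..<1}. 1 - \<sigma> * x < e \<longrightarrow> f x = end_term \<sigma> c P x + end_term \<sigma> d Q x"
    and x: "x \<in> {-1<..<1}" "1 - \<sigma> * x < e"
  shows "vderiv f x = end_term \<sigma> (c + 1) (end_deriv \<sigma> c P) x + end_term \<sigma> (d + 1) (end_deriv \<sigma> d Q) x"
proof (rule vector_derivative_at, rule has_vector_derivative_transform_within_open)
  show "((\<lambda>x. end_term \<sigma> c P x + end_term \<sigma> d Q x) has_vector_derivative
      end_term \<sigma> (c + 1) (end_deriv \<sigma> c P) x + end_term \<sigma> (d + 1) (end_deriv \<sigma> d Q) x) (at x)"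
    using assms(1) x(1) by (intro has_vector_derivative_add has_vector_derivative_end_term) auto
  show "open ({-1<..<1} \<inter> {x. 1 - \<sigma> * x < e})"
    by (intro open_Int open_greaterThanLessThan open_Collect_less continuous_intros)
  show "x \<in> {-1<..<1} \<inter> {x. 1 - \<sigma> * x < e}" using x by simp
qed (use assms(2) in auto)

lemma end_form_add:
  assumes "end_form \<sigma> \<gamma> f P Q" "end_form \<sigma> \<gamma> g R S"
  shows "end_form \<sigma> \<gamma> (\<lambda>x. f x + g x) (P + R) (Q + S)"
proof -
  obtain e d where "e > 0" "\<forall>x\<in>{-1<..<1}. 1 - \<sigma> * x < e \<longrightarrow> f x = end_term \<sigma> 0 P x + end_term \<sigma> \<gamma> Q x"
    "d > 0" "\<forall>x\<in>{-1<..<1}. 1 - \<sigma> * x < d \<longrightarrow> g x = end_term \<sigma> 0 R x + end_term \<sigma> \<gamma> S x"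
    using assms unfolding end_form_def by auto
  then show ?thesis
    unfolding end_form_def
    by (intro exI[of _ "min e d"]) (auto simp: end_term_def algebra_simps)
qed

lemma end_form_cmult:
  assumes "end_form \<sigma> \<gamma> f P Q"
  shows "end_form \<sigma> \<gamma> (\<lambda>x. c * f x) (smult c P) (smult c Q)"
proof -
  obtain e where "e > 0" "\<forall>x\<in>{-1<..<1}. 1 - \<sigma> * x < e \<longrightarrow> f x = end_term \<sigma> 0 P x + end_term \<sigma> \<gamma> Q x"
    using assms unfolding end_form_def by auto
  then show ?thesis
    unfolding end_form_def
    by (intro exI[of _ e]) (auto simp: end_term_def algebra_simps)
qed

lemma end_form_sum:
  assumes "finite A" "\<And>i. i \<in> A \<Longrightarrow> end_form \<sigma> \<gamma> (f i) (P i) (Q i)"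
  shows "end_form \<sigma> \<gamma> (\<lambda>x. \<Sum>i\<in>A. f i x) (\<Sum>i\<in>A. P i) (\<Sum>i\<in>A. Q i)"
  using assms
proof (induction A rule: finite_induct)
  case empty
  show ?case by (auto simp: end_form_def end_term_def intro: exI[of _ 1])
qed (simp add: end_form_add)

section \<open>The induced operator on polynomials\<close>

text \<open>
  The Jacobi expression in the variable \<open>t\<close>, conjugated by \<open>t\<^bsup>-c\<^esup>\<close>. The result has polynomial
  coefficients exactly when \<open>c\<close> is a root of the indicial equation \<open>c (c - \<gamma>) = 0\<close>.
\<close>
definition jacobi_end_poly :: "real \<Rightarrow> real \<Rightarrow> real \<Rightarrow> complex poly \<Rightarrow> complex poly"
  where "jacobi_end_poly \<gamma> \<delta> c P =
    [:0, -2, 1:] * pderiv (pderiv P) +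
    [:- of_real (2 * (1 + \<gamma> - 2 * c)), of_real (\<gamma> + \<delta> + 2 - 2 * c):] * pderiv P +
    smult (of_real (c * (c - (\<gamma> + \<delta> + 1)))) P"

text \<open>Only the coefficients k and k + 1 of P enter, so the order of vanishing at 0 drops by at
  most one. The factor of \<open>coeff P (k + 1)\<close> is -2 (k+1) (k+1+\<gamma>) for c = 0 and -2
  (k+1) (k+1-\<gamma>) for c = \<gamma>.\<close>

lemma coeff_jacobi_end_poly:
  "coeff (jacobi_end_poly \<gamma> \<delta> c P) k =
    of_real (- 2 * real (k + 1) * (real (k + 1) + \<gamma> - 2 * c)) * coeff P (k + 1) +
    of_real ((real k - c) * (real k - c + \<gamma> + \<delta> + 1)) * coeff P k"
  by (cases k; cases "k - 1")
    (simp_all add: jacobi_end_poly_def coeff_pCons coeff_pderiv algebra_simps)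

text \<open>Each application moves the lowest coefficient down by one index and multiplies it by a
  factor that the hypothesis on c keeps nonzero; z is the product of these factors.\<close>

lemma jacobi_end_poly_iterate:
  assumes "\<forall>m<j. coeff P m = 0" "k \<le> j" and c: "\<And>m. real (Suc m) + \<gamma> - 2 * c \<noteq> 0"
  shows "\<exists>z\<noteq>0. (\<forall>m<j-k. coeff ((jacobi_end_poly \<gamma> \<delta> c ^^ k) P) m = 0) \<and>
    coeff ((jacobi_end_poly \<gamma> \<delta> c ^^ k) P) (j - k) = z * coeff P j"
  using assms(2)
proof (induction k)
  case 0
  show ?case using assms(1) by (intro exI[of _ 1]) auto
next
  case (Suc k)
  then obtain z where z: "z \<noteq> 0" "\<forall>m<j-k. coeff ((jacobi_end_poly \<gamma> \<delta> c ^^ k) P) m = 0"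
     "coeff ((jacobi_end_poly \<gamma> \<delta> c ^^ k) P) (j - k) = z * coeff P j"
    by auto
  \<comment> \<open>Index i is the new lowest one: the old coefficient at i vanishes, so only the
    old one at i + 1 contributes.\<close>
  define i where "i = j - Suc k"
  have i: "j - k = Suc i" using Suc.prems by (simp add: i_def)
  let ?w = "of_real (- 2 * real (i + 1) * (real (i + 1) + \<gamma> - 2 * c)) :: complex"
  have "?w \<noteq> 0" using c[of i] by (simp only: of_real_eq_0_iff mult_eq_0_iff) simp
  moreover have "coeff ((jacobi_end_poly \<gamma> \<delta> c ^^ Suc k) P) i = (?w * z) * coeff P j"
    using z(2,3) unfolding i by (simp add: coeff_jacobi_end_poly)
  moreover have "coeff ((jacobi_end_poly \<gamma> \<delta> c ^^ Suc k) P) m = 0" if "m < i" for m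
    using z(2) that unfolding i by (simp add: coeff_jacobi_end_poly)
  ultimately show ?case
    using z(1) by (intro exI[of _ "?w * z"]) (simp add: i_def)
qed

lemma jacobi_end_poly_0: "(jacobi_end_poly \<gamma> \<delta> c ^^ k) 0 = 0"
  by (induction k) (simp_all add: jacobi_end_poly_def)

text \<open>
  The matrix of leading coefficients of iterates is anti-triangular, so only the diagonal term of
  the Lagrange sum survives.
\<close>
lemma jacobi_end_poly_pairing:
  assumes Q: "\<forall>m<j. coeff Q m = 0" and "j < n"
    and c: "\<And>m. real (Suc m) + \<gamma> - 2 * c \<noteq> 0" and d: "\<And>m. real (Suc m) + \<gamma> - 2 * d \<noteq> 0"
  shows "\<exists>z\<noteq>0. (\<Sum>k<n. coeff ((jacobi_end_poly \<gamma> \<delta> d ^^ (n - 1 - k)) Q) 0 *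
      cnj (coeff ((jacobi_end_poly \<gamma> \<delta> c ^^ k) (monom 1 (n - 1 - j))) 0)) = z * coeff Q j"
proof -
  define i where "i = n - 1 - j"
  let ?J = "jacobi_end_poly \<gamma> \<delta>"
  \<comment> \<open>Fewer than j applications leave the constant coefficient of Q at zero.\<close>
  have vQ: "coeff ((?J d ^^ (n - 1 - k)) Q) 0 = 0" if "k < n" "k > i" for k
  proof -
    have "n - 1 - k < j" using that \<open>j < n\<close> by (auto simp: i_def)
    then show ?thesis
      using jacobi_end_poly_iterate[OF Q, of "n - 1 - k" \<gamma> d \<delta>] d by auto
  qed
  \<comment> \<open>Likewise, fewer than i applications do not bring t^i down to a constant.\<close>
  have vR: "coeff ((?J c ^^ k) (monom 1 i)) 0 = 0" if "k < i" for k
    using jacobi_end_poly_iterate[of i "monom 1 i" k \<gamma> c \<delta>] c that by auto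
  obtain z where z: "z \<noteq> 0" "coeff ((?J d ^^ j) Q) 0 = z * coeff Q j"
    using jacobi_end_poly_iterate[OF Q order_refl, of \<gamma> d \<delta>] d by auto
  obtain w where w: "w \<noteq> 0" "coeff ((?J c ^^ i) (monom 1 i)) 0 = w"
    using jacobi_end_poly_iterate[of i "monom 1 i" i \<gamma> c \<delta>] c by auto
  have "(\<Sum>k<n. coeff ((?J d ^^ (n - 1 - k)) Q) 0 * cnj (coeff ((?J c ^^ k) (monom 1 i)) 0)) =
    (\<Sum>k\<in>{i}. coeff ((?J d ^^ (n - 1 - k)) Q) 0 * cnj (coeff ((?J c ^^ k) (monom 1 i)) 0))"
    by (rule sum.mono_neutral_right) (use \<open>j < n\<close> vQ vR in \<open>auto simp: i_def neq_iff\<close>)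
  also have "\<dots> = (z * cnj w) * coeff Q j"
  proof -
    have "n - 1 - i = j" using \<open>j < n\<close> by (simp add: i_def)
    then show ?thesis using z w by simp
  qed
  finally show ?thesis using z(1) w(1) unfolding i_def by (intro exI[of _ "z * cnj w"]) auto
qed

section \<open>The Jacobi expression at one end\<close>

text \<open>One locale serves both ends: \<gamma> is the weight exponent at the end \<sigma>,
  \<delta> the one at the other end, and \<open>opposite\<close> exchanges them. Positivity of
  \<gamma> separates the exponents 0 and -\<gamma> and makes the factor \<gamma> of the boundary
  pairing nonzero.\<close>

locale jacobi_endpoint =
  fixes \<alpha> \<beta> \<sigma> \<gamma> \<delta> :: real
  assumes endpoint: "\<sigma> = 1 \<and> \<gamma> = \<alpha> \<and> \<delta> = \<beta> \<or> \<sigma> = -1 \<and> \<gamma> = \<beta> \<and> \<delta> = \<alpha>"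
    and exponents: "0 < \<gamma>" "\<gamma> < 1" "0 < \<delta>" "\<delta> < 1"
begin

lemma sign: "\<sigma> = 1 \<or> \<sigma> = -1"
  using endpoint by blast

lemma sign_square: "\<sigma> * \<sigma> = 1"
  using sign by auto

lemma opposite: "jacobi_endpoint \<alpha> \<beta> (-\<sigma>) \<delta> \<gamma>"
  by unfold_locales (use endpoint exponents in auto)

lemma inside: "x \<in> {-1<..<1} \<Longrightarrow> 1 - \<sigma> * x > 0 \<and> 1 + \<sigma> * x > 0 \<and> 1 - \<sigma> * x < 2 \<and> 1 + \<sigma> * x < 2"
  using sign by auto

lemma weight_eq: "jacobi_weight \<alpha> \<beta> x = (1 - \<sigma> * x) powr \<gamma> * (1 + \<sigma> * x) powr \<delta>"
  using endpoint by (auto simp: jacobi_weight_def)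

lemma leading_eq: "(1 - x) powr (\<alpha> + 1) * (1 + x) powr (\<beta> + 1) =
    (1 - \<sigma> * x) powr (\<gamma> + 1) * (1 + \<sigma> * x) powr (\<delta> + 1)"
  using endpoint by auto

text \<open>With x = \<sigma> (1 - t), the left side is t^(-c-1) times a polynomial in t that is a
  multiple of t up to a term 2 c (c - \<gamma>) P. The indicial equation removes this term, and
  cancelling t leaves \<open>jacobi_end_poly\<close>.\<close>

lemma jacobi_end_term:
  assumes x: "x \<in> {-1<..<1}" and c: "c * (c - \<gamma>) = 0"
  shows "- ((1 - x\<^sup>2) *\<^sub>R end_term \<sigma> (c + 1 + 1) (end_deriv \<sigma> (c + 1) (end_deriv \<sigma> c P)) x +
      (\<beta> - \<alpha> - (\<alpha> + \<beta> + 2) * x) *\<^sub>R end_term \<sigma> (c + 1) (end_deriv \<sigma> c P) x) =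
    end_term \<sigma> c (jacobi_end_poly \<gamma> \<delta> c P) x"
proof -
  define t where "t = 1 - \<sigma> * x"
  have t: "t > 0" using inside[OF x] by (simp add: t_def)
  have x_eq: "x = \<sigma> * (1 - t)" using sign_square by (simp add: t_def flip: mult.assoc)
  have a: "1 - x\<^sup>2 = t * (2 - t)"
  proof -
    have "x\<^sup>2 = (\<sigma> * \<sigma>) * (1 - t)\<^sup>2"
      unfolding x_eq by (simp add: power2_eq_square)
    then show ?thesis
      unfolding sign_square by (simp add: power2_eq_square algebra_simps)
  qed
  \<comment> \<open>The sign \<sigma> here meets the sign in \<open>end_deriv\<close>, and
    \<sigma>^2 = 1 makes the result the same at both ends.\<close>
  have b: "\<beta> - \<alpha> - (\<alpha> + \<beta> + 2) * x = \<sigma> * (- 2 * \<gamma> - 2 + (\<gamma> + \<delta> + 2) * t)"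
    using endpoint unfolding x_eq by (auto simp: algebra_simps)
  define u where "u = complex_of_real (t powr (-c))"
  define T where "T = complex_of_real t"
  define C where "C = complex_of_real c"
  define G where "G = complex_of_real \<gamma>"
  define D where "D = complex_of_real \<delta>"
  define S where "S = complex_of_real \<sigma>"
  have p1: "complex_of_real (t powr (- (c + 1))) = u / T" "complex_of_real (t powr (- (c + 1 + 1))) = u / T^2"
    using t by (simp_all add: u_def T_def powr_diff powr_minus powr_add power2_eq_square field_simps)
  have T: "T \<noteq> 0" using t by (simp add: T_def)
  have C: "C * (C - G) = 0"
    using c unfolding C_def G_def by (metis of_real_0 of_real_diff of_real_mult)
  have S: "S * S = 1" using sign_square unfolding S_def by (metis of_real_1 of_real_mult)
  define p p' p'' where "p = poly P T" and "p' = poly (pderiv P) T" and "p'' = poly (pderiv (pderiv P)) T"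
  have e1: "poly (end_deriv \<sigma> c P) T = - S * (T * p' - C * p)"
    by (simp add: end_deriv_def p_def p'_def S_def C_def algebra_simps)
  have e2: "poly (end_deriv \<sigma> (c + 1) (end_deriv \<sigma> c P)) T =
      (S * S) * (T * (p' + T * p'' - C * p') - (C + 1) * (T * p' - C * p))"
    by (simp add: end_deriv_def pderiv_mult pderiv_smult pderiv_diff pderiv_minus pderiv_pCons p_def p'_def p''_def S_def C_def algebra_simps)
  have e3: "poly (jacobi_end_poly \<gamma> \<delta> c P) T = T * (T - 2) * p'' +
      (- 2 * (1 + G - 2 * C) + (G + D + 2 - 2 * C) * T) * p' + C * (C - (G + D + 1)) * p"
    by (simp add: jacobi_end_poly_def p_def p'_def p''_def G_def D_def C_def algebra_simps)
  have "- (T * (2 - T) * (u / T^2 * (T * (p' + T * p'' - C * p') - (C + 1) * (T * p' - C * p))) +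
      S * (- 2 * G - 2 + (G + D + 2) * T) * (u / T * (- S * (T * p' - C * p)))) =
     - u / T * ((2 - T) * (T * (p' + T * p'' - C * p') - (C + 1) * (T * p' - C * p)) -
      (S * S) * (- 2 * G - 2 + (G + D + 2) * T) * (T * p' - C * p))"
    using T by (simp add: field_simps power2_eq_square)
  \<comment> \<open>The indicial factor \<open>C * (C - G)\<close> is split off; it is zero by
    hypothesis.\<close>
  also have "\<dots> = - u / T * (- T * (T * (T - 2) * p'' +
      (- 2 * (1 + G - 2 * C) + (G + D + 2 - 2 * C) * T) * p' + C * (C - (G + D + 1)) * p) + 2 * (C * (C - G)) * p)"
    unfolding S by (simp add: algebra_simps)
  also have "\<dots> = u * (T * (T - 2) * p'' +
      (- 2 * (1 + G - 2 * C) + (G + D + 2 - 2 * C) * T) * p' + C * (C - (G + D + 1)) * p)"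
    unfolding C using T by simp
  finally show ?thesis
    unfolding end_term_def t_def[symmetric] p1 a b T_def[symmetric] u_def[symmetric] e1 e2 e3 S
    by (simp add: scaleR_conv_of_real G_def D_def S_def T_def C_def)
qed

text \<open>Both c = 0 and c = \<gamma> are roots of the indicial equation, so
  \<open>jacobi_end_term\<close> applies to each of the two terms of the end form.\<close>

lemma end_form_jacobi_expr:
  assumes "smooth_on_interval f" "end_form \<sigma> \<gamma> f P Q"
  shows "end_form \<sigma> \<gamma> (jacobi_expr \<alpha> \<beta> f) (jacobi_end_poly \<gamma> \<delta> 0 P) (jacobi_end_poly \<gamma> \<delta> \<gamma> Q)"
proof -
  obtain e where e: "e > 0"
    "\<forall>x\<in>{-1<..<1}. 1 - \<sigma> * x < e \<longrightarrow> f x = end_term \<sigma> 0 P x + end_term \<sigma> \<gamma> Q x"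
    using assms(2) unfolding end_form_def by auto
  note d1 = vderiv_end_terms[OF sign e(2)]
  have d1': "\<forall>x\<in>{-1<..<1}. 1 - \<sigma> * x < e \<longrightarrow> vderiv f x = end_term \<sigma> (0 + 1) (end_deriv \<sigma> 0 P) x +
      end_term \<sigma> (\<gamma> + 1) (end_deriv \<sigma> \<gamma> Q) x"
    using d1 by blast
  note d2 = vderiv_end_terms[OF sign d1']
  show ?thesis
    unfolding end_form_def
  proof (intro exI[of _ e] conjI ballI impI e(1))
    fix x assume x: "x \<in> {-1<..<1}" "1 - \<sigma> * x < e"
    show "jacobi_expr \<alpha> \<beta> f x = end_term \<sigma> 0 (jacobi_end_poly \<gamma> \<delta> 0 P) x + end_term \<sigma> \<gamma> (jacobi_end_poly \<gamma> \<delta> \<gamma> Q) x"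
      unfolding jacobi_expr_explicit[OF assms(1) x(1)] d1[OF x] d2[OF x]
        jacobi_end_term[OF x(1), of 0 P, simplified mult_zero_left, OF refl, symmetric]
        jacobi_end_term[OF x(1), of \<gamma> Q, simplified diff_self mult_zero_right, OF refl, symmetric]
      by (simp add: scaleR_add_right)
  qed
qed

lemma end_form_jacobi_power:
  assumes "smooth_on_interval f" "end_form \<sigma> \<gamma> f P Q"
  shows "end_form \<sigma> \<gamma> (jacobi_power \<alpha> \<beta> k f)
    ((jacobi_end_poly \<gamma> \<delta> 0 ^^ k) P) ((jacobi_end_poly \<gamma> \<delta> \<gamma> ^^ k) Q)"
proof (induction k)
  case (Suc k)
  show ?case
    using end_form_jacobi_expr[OF smooth_jacobi_power[OF assms(1)] Suc] by (simp add: jacobi_power_def)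
qed (use assms in \<open>simp add: jacobi_power_def\<close>)

end

section \<open>Lagrange identity and boundary values\<close>

text \<open>This is the boundary form of the Jacobi expression, signed so that it is an
  antiderivative of the integrand of \<open>sesqui_form\<close> for n = 1.\<close>

definition wronskian :: "real \<Rightarrow> real \<Rightarrow> (real \<Rightarrow> complex) \<Rightarrow> (real \<Rightarrow> complex) \<Rightarrow> real \<Rightarrow> complex"
  where "wronskian \<alpha> \<beta> f g x = of_real ((1 - x) powr (\<alpha> + 1) * (1 + x) powr (\<beta> + 1)) *
    (f x * cnj (vderiv g x) - vderiv f x * cnj (g x))"

text \<open>The Lagrange identity: apply the product rule with (p h')' = - w
  \<open>jacobi_expr\<close> h for h = f and h = g; the terms with p f' cnj(g') cancel.\<close>

lemma has_vector_derivative_wronskian: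
  assumes "smooth_on_interval f" "smooth_on_interval g" "x \<in> {-1<..<1}"
  shows "(wronskian \<alpha> \<beta> f g has_vector_derivative
    (jacobi_expr \<alpha> \<beta> f x * cnj (g x) - f x * cnj (jacobi_expr \<alpha> \<beta> g x)) *
      of_real (jacobi_weight \<alpha> \<beta> x)) (at x)"
proof -
  define p where "p t = (1 - t) powr (\<alpha> + 1) * (1 + t) powr (\<beta> + 1)" for t
  define w where "w = jacobi_weight \<alpha> \<beta> x"
  have pd: "((\<lambda>t. p t *\<^sub>R vderiv h t) has_vector_derivative - (w *\<^sub>R jacobi_expr \<alpha> \<beta> h x)) (at x)"
    if "smooth_on_interval h" for h
    using jacobi_leading_deriv[OF that assms(3), of \<alpha> \<beta>]
    unfolding jacobi_expr_explicit[OF that assms(3)] p_def w_def scaleR_minus_right minus_minus .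
  note fd = smooth_has_vderiv[OF assms(1,3)] and gd = smooth_has_vderiv[OF assms(2,3)]
  have "((\<lambda>t. f t * cnj (p t *\<^sub>R vderiv g t) - (p t *\<^sub>R vderiv f t) * cnj (g t)) has_vector_derivative
     (f x * cnj (- (w *\<^sub>R jacobi_expr \<alpha> \<beta> g x)) + vderiv f x * cnj (p x *\<^sub>R vderiv g x)) -
     ((p x *\<^sub>R vderiv f x) * cnj (vderiv g x) + (- (w *\<^sub>R jacobi_expr \<alpha> \<beta> f x)) * cnj (g x))) (at x)"
    by (intro has_vector_derivative_diff has_vector_derivative_mult has_vector_derivative_cnj
        fd gd pd assms)
  moreover have "wronskian \<alpha> \<beta> f g =
      (\<lambda>t. f t * cnj (p t *\<^sub>R vderiv g t) - (p t *\<^sub>R vderiv f t) * cnj (g t))"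
    by (simp add: fun_eq_iff wronskian_def p_def scaleR_conv_of_real algebra_simps)
  ultimately show ?thesis
    by (auto simp: w_def scaleR_conv_of_real algebra_simps elim!: has_vector_derivative_eq_rhs)
qed

text \<open>This is the fundamental theorem of calculus with limits of F from inside the interval as
  boundary terms. The remaining steps pass between \<open>lborel\<close> and its completion
  \<open>lebesgue\<close>.\<close>

lemma set_integral_derivative_Ioo:
  fixes F h :: "real \<Rightarrow> complex"
  assumes "\<And>x. x \<in> {-1<..<1} \<Longrightarrow> (F has_vector_derivative h x) (at x)"
    and "continuous_on {-1<..<1} h" "set_integrable lebesgue {-1<..<1} h"
    and "(F \<longlongrightarrow> A) (at (-1) within {-1<..<1})" "(F \<longlongrightarrow> B) (at 1 within {-1<..<1})"
  shows "set_lebesgue_integral lebesgue {-1<..<1} h = B - A"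
proof -
  have meas: "(\<lambda>x. indicator {-1<..<1} x *\<^sub>R h x) \<in> borel_measurable lborel"
    using borel_measurable_continuous_on_indicator[OF _ assms(2)] by simp
  have int: "set_integrable lborel {-1<..<1} h"
    using assms(3) integrable_completion[OF meas] by (simp add: set_integrable_def)
  have "(LBINT x=ereal (-1)..ereal 1. h x) = B - A"
  proof (rule interval_integral_FTC_integrable)
    show "set_integrable lborel (einterval (ereal (- 1)) (ereal 1)) h"
      using int by (simp only: einterval_eq)
    show "isCont h x" if "ereal (-1) < ereal x" "ereal x < ereal 1" for x
      using assms(2) that by (simp add: continuous_on_eq_continuous_at)
    have "at (-1) within {-1<..<1::real} = at_right (-1)"
      by (rule at_within_nhd[of _ "{..<1}"]) auto
    moreover have "at 1 within {-1<..<1::real} = at_left 1"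
      by (rule at_within_nhd[of _ "{-1<..}"]) auto
    ultimately show "((F \<circ> real_of_ereal) \<longlongrightarrow> A) (at_right (ereal (-1)))"
      "((F \<circ> real_of_ereal) \<longlongrightarrow> B) (at_left (ereal 1))"
      using assms(4,5) by (simp_all only: ereal_tendsto_simps1)
  qed (use assms(1) in auto)
  then have "set_lebesgue_integral lborel {-1<..<1} h = B - A"
    by (simp add: interval_lebesgue_integral_def einterval_eq flip: einterval_eq)
  then show ?thesis
    unfolding set_lebesgue_integral_def using integral_completion[OF meas] by simp
qed

text \<open>Pointwise |f g| \<le> |f|^2 + |g|^2, so the product is dominated by the sum of two
  integrable densities.\<close>

lemma set_integrable_L2_product:
  assumes "f \<in> L2_jacobi \<alpha> \<beta>" "g \<in> L2_jacobi \<alpha> \<beta>"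
    and "continuous_on {-1<..<1} f" "continuous_on {-1<..<1} g"
  shows "set_integrable lebesgue {-1<..<1} (\<lambda>x. f x * cnj (g x) * of_real (jacobi_weight \<alpha> \<beta> x))"
proof (rule set_integrable_bound)
  show "set_integrable lebesgue {-1<..<1}
      (\<lambda>x. (norm (f x))\<^sup>2 * jacobi_weight \<alpha> \<beta> x + (norm (g x))\<^sup>2 * jacobi_weight \<alpha> \<beta> x)"
    using assms by (intro set_integral_add) (auto simp: L2_jacobi_def)
  show "set_borel_measurable lebesgue {-1<..<1} (\<lambda>x. f x * cnj (g x) * of_real (jacobi_weight \<alpha> \<beta> x))"
    by (intro set_borel_measurable_open_continuous continuous_intros assms continuous_on_jacobi_weight)
  show "AE x in lebesgue. x \<in> {-1<..<1} \<longrightarrow> norm (f x * cnj (g x) * of_real (jacobi_weight \<alpha> \<beta> x))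
      \<le> norm ((norm (f x))\<^sup>2 * jacobi_weight \<alpha> \<beta> x + (norm (g x))\<^sup>2 * jacobi_weight \<alpha> \<beta> x)"
  proof (intro AE_I2 impI)
    fix x :: real assume x: "x \<in> {-1<..<1}"
    have w: "jacobi_weight \<alpha> \<beta> x > 0" by (rule jacobi_weight_pos[OF x])
    have "2 * (norm (f x) * norm (g x)) \<le> (norm (f x))\<^sup>2 + (norm (g x))\<^sup>2"
      using sum_squares_bound[of "norm (f x)" "norm (g x)"] by simp
    moreover have "0 \<le> norm (f x) * norm (g x)" by simp
    ultimately have "norm (f x) * norm (g x) \<le> (norm (f x))\<^sup>2 + (norm (g x))\<^sup>2" by linarith
    from mult_right_mono[OF this less_imp_le[OF w]]
    show "norm (f x * cnj (g x) * of_real (jacobi_weight \<alpha> \<beta> x))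
      \<le> norm ((norm (f x))\<^sup>2 * jacobi_weight \<alpha> \<beta> x + (norm (g x))\<^sup>2 * jacobi_weight \<alpha> \<beta> x)"
      using w by (simp add: norm_mult algebra_simps)
  qed
qed

text \<open>With a(k) = B (L^(n-k) f) (L^k g), the summand is a(k) - a(k+1): one application of L at
  a time is moved from f to g.\<close>

lemma sum_iterate_telescope:
  fixes L :: "'a \<Rightarrow> 'a" and B :: "'a \<Rightarrow> 'a \<Rightarrow> 'b::ab_group_add"
  shows "(\<Sum>k<n. B ((L ^^ Suc (n - 1 - k)) f) ((L ^^ k) g) - B ((L ^^ (n - 1 - k)) f) ((L ^^ Suc k) g)) =
    B ((L ^^ n) f) g - B f ((L ^^ n) g)"
proof -
  have "(\<Sum>k<n. B ((L ^^ Suc (n - 1 - k)) f) ((L ^^ k) g) - B ((L ^^ (n - 1 - k)) f) ((L ^^ Suc k) g)) =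
    (\<Sum>k<n. B ((L ^^ (n - k)) f) ((L ^^ k) g) - B ((L ^^ (n - Suc k)) f) ((L ^^ Suc k) g))"
    by (intro sum.cong) (auto simp: Suc_diff_Suc simp del: funpow.simps)
  also have "\<dots> = B ((L ^^ n) f) g - B f ((L ^^ n) g)"
    by (subst sum_lessThan_telescope') simp
  finally show ?thesis .
qed

text \<open>The Lagrange identity of order n: by \<open>sum_iterate_telescope\<close>, the sum of
  the Wronskians is an antiderivative of the integrand of \<open>sesqui_form\<close>. The L^2
  hypotheses make that integrand integrable.\<close>

lemma sesqui_form_eq_boundary_values:
  assumes f: "smooth_on_interval f" "f \<in> L2_jacobi \<alpha> \<beta>" "jacobi_power \<alpha> \<beta> n f \<in> L2_jacobi \<alpha> \<beta>"
    and g: "smooth_on_interval g" "g \<in> L2_jacobi \<alpha> \<beta>" "jacobi_power \<alpha> \<beta> n g \<in> L2_jacobi \<alpha> \<beta>"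
    and A: "\<And>k. k < n \<Longrightarrow> (wronskian \<alpha> \<beta> (jacobi_power \<alpha> \<beta> (n - 1 - k) f) (jacobi_power \<alpha> \<beta> k g)
      \<longlongrightarrow> A k) (at (-1) within {-1<..<1})"
    and B: "\<And>k. k < n \<Longrightarrow> (wronskian \<alpha> \<beta> (jacobi_power \<alpha> \<beta> (n - 1 - k) f) (jacobi_power \<alpha> \<beta> k g)
      \<longlongrightarrow> B k) (at 1 within {-1<..<1})"
  shows "sesqui_form \<alpha> \<beta> n f g = (\<Sum>k<n. B k) - (\<Sum>k<n. A k)"
  unfolding sesqui_form_def
proof (rule set_integral_derivative_Ioo)
  let ?l = "jacobi_power \<alpha> \<beta>" and ?I = "{-1<..<1::real}" and ?w = "\<lambda>x. complex_of_real (jacobi_weight \<alpha> \<beta> x)"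
  let ?W = "\<lambda>x. \<Sum>k<n. wronskian \<alpha> \<beta> (?l (n - 1 - k) f) (?l k g) x"
  have s: "smooth_on_interval (?l k f)" "smooth_on_interval (?l k g)" for k
    by (intro smooth_jacobi_power f g)+
  note c = s[THEN smooth_continuous_on] f(1)[THEN smooth_continuous_on] g(1)[THEN smooth_continuous_on]
  show "(?W has_vector_derivative (?l n f x * cnj (g x) - f x * cnj (?l n g x)) * ?w x) (at x)"
    if x: "x \<in> ?I" for x
  proof -
    have "(?W has_vector_derivative (\<Sum>k<n. (?l (Suc (n - 1 - k)) f x * cnj (?l k g x) -
        ?l (n - 1 - k) f x * cnj (?l (Suc k) g x)) * ?w x)) (at x)"
      using has_vector_derivative_wronskian[OF s x, of \<alpha> \<beta>]
      by (intro has_vector_derivative_sum) (simp add: jacobi_power_def)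
    moreover have "(\<Sum>k<n. (?l (Suc (n - 1 - k)) f x * cnj (?l k g x) -
        ?l (n - 1 - k) f x * cnj (?l (Suc k) g x)) * ?w x) = (?l n f x * cnj (g x) - f x * cnj (?l n g x)) * ?w x"
      unfolding sum_distrib_right[symmetric] jacobi_power_def
      by (subst sum_iterate_telescope[of "\<lambda>u v. u x * cnj (v x)"]) simp
    ultimately show ?thesis by simp
  qed
  show "continuous_on ?I (\<lambda>x. (?l n f x * cnj (g x) - f x * cnj (?l n g x)) * ?w x)"
    by (intro continuous_intros c continuous_on_jacobi_weight)
  have "set_integrable lebesgue ?I (\<lambda>x. ?l n f x * cnj (g x) * ?w x - f x * cnj (?l n g x) * ?w x)"
    by (intro set_integral_diff set_integrable_L2_product f g c)
  then show "set_integrable lebesgue ?I (\<lambda>x. (?l n f x * cnj (g x) - f x * cnj (?l n g x)) * ?w x)"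
    by (simp add: left_diff_distrib)
  show "(?W \<longlongrightarrow> (\<Sum>k<n. A k)) (at (-1) within ?I)" "(?W \<longlongrightarrow> (\<Sum>k<n. B k)) (at 1 within ?I)"
    by (intro tendsto_sum; use A B in simp)+
qed

lemma end_form_zero: "end_form \<sigma> \<gamma> f 0 0 \<longleftrightarrow> (\<exists>e>0. \<forall>x\<in>{-1<..<1}. 1 - \<sigma> * x < e \<longrightarrow> f x = 0)"
  by (simp add: end_form_def end_term_def)

section \<open>Boundary values in terms of end forms\<close>

context jacobi_endpoint
begin

text \<open>On (-1,1) the quantity 1 - \<sigma> x is the distance from x to the endpoint
  \<sigma>.\<close>

lemma eventually_endpoint:
  assumes "e > 0" "\<And>x. x \<in> {-1<..<1} \<Longrightarrow> 1 - \<sigma> * x < e \<Longrightarrow> P x"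
  shows "eventually P (at \<sigma> within {-1<..<1})"
  unfolding eventually_at using assms sign
  by (intro exI[of _ e]) (auto simp: dist_real_def)

text \<open>Near the end f = t^(-\<gamma>) y, where y = t^\<gamma> P + Q is bounded by M on [0,2].
  Hence |f|^2 w \<le> M^2 t^(-2\<gamma>) t^\<gamma> 2, where 2 bounds the weight factor of the other
  end.\<close>

lemma end_form_bound:
  assumes "end_form \<sigma> \<gamma> f P Q"
  shows "\<exists>e>0. \<exists>C. \<forall>x\<in>{-1<..<1}. 1 - \<sigma> * x < e \<longrightarrow>
    \<bar>(norm (f x))\<^sup>2 * jacobi_weight \<alpha> \<beta> x\<bar> \<le> C * (1 - \<sigma> * x) powr (-\<gamma>)"
proof -
  obtain e where e: "e > 0"
    "\<forall>x\<in>{-1<..<1}. 1 - \<sigma> * x < e \<longrightarrow> f x = end_term \<sigma> 0 P x + end_term \<sigma> \<gamma> Q x"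
    using assms unfolding end_form_def by auto
  have "compact ((\<lambda>t. of_real (t powr \<gamma>) * poly P (of_real t) + poly Q (of_real t)) ` {0..2})"
    using exponents by (intro compact_continuous_image) (auto intro!: continuous_intros continuous_on_powr')
  then have "bounded ((\<lambda>t. of_real (t powr \<gamma>) * poly P (of_real t) + poly Q (of_real t)) ` {0..2})"
    by (rule compact_imp_bounded)
  then obtain M where M: "\<forall>y\<in>(\<lambda>t. of_real (t powr \<gamma>) * poly P (of_real t) + poly Q (of_real t)) ` {0..2}. norm y \<le> M"
    unfolding bounded_iff by (elim exE)
  show ?thesis
  proof (rule exI[of _ e], intro exI[of _ "2 * M\<^sup>2"] conjI ballI impI e(1))
    fix x assume x: "x \<in> {-1<..<1}" "1 - \<sigma> * x < e"
    define t where "t = 1 - \<sigma> * x"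
    have t: "0 < t" "t < 2" using inside[OF x(1)] by (auto simp: t_def)
    define u where "u = t powr \<gamma>"
    have u: "u > 0" "t powr (-\<gamma>) = 1 / u" using t by (auto simp: u_def powr_minus field_simps)
    define y where "y = of_real u * poly P (of_real t) + poly Q (of_real t)"
    have y: "norm y \<le> M" using M t by (simp add: y_def u_def)
    have "f x = end_term \<sigma> 0 P x + end_term \<sigma> \<gamma> Q x" using e(2) x by blast
    then have "f x = of_real (1 / u) * y"
      using t u unfolding end_term_def t_def[symmetric] by (simp add: y_def field_simps)
    then have nf: "norm (f x) = norm y / u" using u by (simp add: norm_mult norm_divide)
    have d: "(1 + \<sigma> * x) powr \<delta> \<le> 2"
    proof -
      have "(1 + \<sigma> * x) powr \<delta> \<le> 2 powr \<delta>"
        using inside[OF x(1)] exponents by (intro powr_mono2) auto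
      also have "\<dots> \<le> 2 powr 1" using exponents by (intro powr_mono) auto
      finally show ?thesis by simp
    qed
    have "(norm (f x))\<^sup>2 * jacobi_weight \<alpha> \<beta> x = (norm y)\<^sup>2 * (1 + \<sigma> * x) powr \<delta> * (1 / u)"
      unfolding weight_eq nf t_def[symmetric] u_def[symmetric] using u
      by (simp add: power2_eq_square field_simps)
    also have "\<dots> \<le> M\<^sup>2 * 2 * (1 / u)"
      using y d u by (intro mult_right_mono mult_mono power_mono) auto
    finally show "\<bar>(norm (f x))\<^sup>2 * jacobi_weight \<alpha> \<beta> x\<bar> \<le> 2 * M\<^sup>2 * (1 - \<sigma> * x) powr (-\<gamma>)"
      unfolding t_def[symmetric] u using jacobi_weight_pos[OF x(1), of \<alpha> \<beta>] by (simp add: mult.commute)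
  qed
qed

text \<open>Multiplied out, the Wronskian carries only the powers t^\<gamma>, t^0 and t^(1-\<gamma>)
  times continuous functions, because the contributions \<gamma> Q cnj(S) from the two singular
  terms cancel. As t tends to 0, only the t^0 part survives.\<close>

lemma tendsto_wronskian:
  assumes "end_form \<sigma> \<gamma> f P Q" "end_form \<sigma> \<gamma> g R S"
  shows "(wronskian \<alpha> \<beta> f g \<longlongrightarrow> of_real (\<sigma> * \<gamma> * 2 powr (\<delta> + 1)) *
    (coeff P 0 * cnj (coeff S 0) - coeff Q 0 * cnj (coeff R 0))) (at \<sigma> within {-1<..<1})"
proof -
  obtain e where e: "e > 0"
    "\<forall>x\<in>{-1<..<1}. 1 - \<sigma> * x < e \<longrightarrow> f x = end_term \<sigma> 0 P x + end_term \<sigma> \<gamma> Q x"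
    using assms unfolding end_form_def by auto
  obtain d where d: "d > 0"
    "\<forall>x\<in>{-1<..<1}. 1 - \<sigma> * x < d \<longrightarrow> g x = end_term \<sigma> 0 R x + end_term \<sigma> \<gamma> S x"
    using assms unfolding end_form_def by auto
  \<comment> \<open>V is the Wronskian as a function of t, arranged by these three powers so that it
    can be evaluated at t = 0.\<close>
  define V where "V t = of_real (\<sigma> * (2 - t) powr (\<delta> + 1)) * (of_real (t powr \<gamma>) *
       (of_real t * poly (pderiv P) (of_real t) * cnj (poly R (of_real t)) -
        poly P (of_real t) * cnj (of_real t * poly (pderiv R) (of_real t))) +
      (of_real t * poly (pderiv P) (of_real t) * cnj (poly S (of_real t)) -
       poly Q (of_real t) * cnj (of_real t * poly (pderiv R) (of_real t)) +
       (of_real t * poly (pderiv Q) (of_real t) - of_real \<gamma> * poly Q (of_real t)) * cnj (poly R (of_real t)) -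
       poly P (of_real t) * cnj (of_real t * poly (pderiv S) (of_real t) - of_real \<gamma> * poly S (of_real t))) +
      of_real (t powr (1 - \<gamma>)) * (poly (pderiv Q) (of_real t) * cnj (poly S (of_real t)) -
        poly Q (of_real t) * cnj (poly (pderiv S) (of_real t))))" for t :: real
  have "((\<lambda>x. V (1 - \<sigma> * x)) \<longlongrightarrow> V (1 - \<sigma> * \<sigma>)) (at \<sigma> within {-1<..<1})"
    unfolding V_def
    by (intro tendsto_intros tendsto_powr' disjI2 conjI eventually_endpoint[of 1])
      (use exponents sign inside in \<open>auto simp: less_imp_le\<close>)
  then have lim: "((\<lambda>x. V (1 - \<sigma> * x)) \<longlongrightarrow> V 0) (at \<sigma> within {-1<..<1})"
    by (simp add: sign_square)
  have V0: "V 0 = of_real (\<sigma> * \<gamma> * 2 powr (\<delta> + 1)) *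
    (coeff P 0 * cnj (coeff S 0) - coeff Q 0 * cnj (coeff R 0))"
    by (simp add: V_def poly_0_coeff_0 algebra_simps)
  have "eventually (\<lambda>x. V (1 - \<sigma> * x) = wronskian \<alpha> \<beta> f g x) (at \<sigma> within {-1<..<1})"
  proof (rule eventually_endpoint[of "min e d"])
    fix x assume x: "x \<in> {-1<..<1}" "1 - \<sigma> * x < min e d"
    define t where "t = 1 - \<sigma> * x"
    have t: "t > 0" using inside[OF x(1)] by (simp add: t_def)
    define T where "T = complex_of_real t"
    define u where "u = complex_of_real (t powr \<gamma>)"
    have u: "complex_of_real (t powr (-\<gamma>)) = 1 / u" "complex_of_real (t powr (-(\<gamma> + 1))) = 1 / (u * T)"
      "complex_of_real (t powr (\<gamma> + 1)) = u * T" "complex_of_real (t powr (1 - \<gamma>)) = T / u"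
      "complex_of_real (t powr (- 1)) = 1 / T"
      using t by (simp_all add: u_def T_def powr_add powr_diff powr_minus field_simps)
    have nz: "u \<noteq> 0" "T \<noteq> 0" "cnj T = T" "cnj u = u" using t by (auto simp: u_def T_def)
    have x_eq: "1 + \<sigma> * x = 2 - t" by (simp add: t_def)
    have fx: "f x = poly P T + 1 / u * poly Q T" "g x = poly R T + 1 / u * poly S T"
    proof -
      have "f x = end_term \<sigma> 0 P x + end_term \<sigma> \<gamma> Q x" "g x = end_term \<sigma> 0 R x + end_term \<sigma> \<gamma> S x"
        using e(2) d(2) x by simp_all
      then show "f x = poly P T + 1 / u * poly Q T" "g x = poly R T + 1 / u * poly S T"
        using t unfolding end_term_def t_def[symmetric] by (simp_all add: u T_def)
    qed
    have dE: "poly (end_deriv \<sigma> c A) T = - of_real \<sigma> * (T * poly (pderiv A) T - of_real c * poly A T)" for c A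
      by (simp add: end_deriv_def algebra_simps)
    have dfx: "vderiv f x = - of_real \<sigma> * (1 / T * (T * poly (pderiv P) T) +
        1 / (u * T) * (T * poly (pderiv Q) T - of_real \<gamma> * poly Q T))"
    proof -
      have less: "1 - \<sigma> * x < e" using x(2) by simp
      then show ?thesis
        unfolding vderiv_end_terms[OF sign e(2) x(1) less] end_term_def t_def[symmetric] add_0 u T_def[symmetric] dE
        by (simp only: of_real_0 mult_zero_left diff_zero distrib_left mult_ac)
    qed
    have dgx: "vderiv g x = - of_real \<sigma> * (1 / T * (T * poly (pderiv R) T) +
        1 / (u * T) * (T * poly (pderiv S) T - of_real \<gamma> * poly S T))"
    proof -
      have less: "1 - \<sigma> * x < d" using x(2) by simp
      then show ?thesis
        unfolding vderiv_end_terms[OF sign d(2) x(1) less] end_term_def t_def[symmetric] add_0 u T_def[symmetric] dE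
        by (simp only: of_real_0 mult_zero_left diff_zero distrib_left mult_ac)
    qed
    define K where "K = complex_of_real ((2 - t) powr (\<delta> + 1))"
    define p q r s p' q' r' s' G where "p = poly P T" and "q = poly Q T" and "r = cnj (poly R T)" and "s = cnj (poly S T)"
      and "p' = poly (pderiv P) T" and "q' = poly (pderiv Q) T" and "r' = cnj (poly (pderiv R) T)"
      and "s' = cnj (poly (pderiv S) T)" and "G = complex_of_real \<gamma>"
    note defs = p_def q_def r_def s_def p'_def q'_def r'_def s'_def G_def
    have "wronskian \<alpha> \<beta> f g x = (u * T * K) *
      ((p + 1 / u * q) * (- of_real \<sigma> * (1 / T * (T * r') + 1 / (u * T) * (T * s' - G * s))) -
       (- of_real \<sigma> * (1 / T * (T * p') + 1 / (u * T) * (T * q' - G * q))) * (r + 1 / u * s))"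
      unfolding wronskian_def leading_eq t_def[symmetric] x_eq of_real_mult u fx dfx dgx K_def defs
      by (simp add: nz)
    also have "\<dots> = of_real \<sigma> * K * (u * (T * p' * r - p * (T * r')) +
       (T * p' * s - q * (T * r') + (T * q' - G * q) * r - p * (T * s' - G * s)) + T / u * (q' * s - q * s'))"
      using nz(1,2) by (simp add: field_simps)
    also have "\<dots> = V t"
      unfolding V_def u T_def[symmetric] u_def[symmetric] defs K_def
      by (simp add: nz)
    finally show "V (1 - \<sigma> * x) = wronskian \<alpha> \<beta> f g x" by (simp add: t_def)
  qed (use e(1) d(1) in simp)
  from Lim_transform_eventually[OF lim this] show ?thesis by (simp only: V0)
qed

lemma smooth_end_forms_in_L2:
  assumes "smooth_on_interval f" "end_form \<sigma> \<gamma> f P Q" "end_form (-\<sigma>) \<delta> f P' Q'"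
  shows "f \<in> L2_jacobi \<alpha> \<beta>"
proof -
  interpret opp: jacobi_endpoint \<alpha> \<beta> "-\<sigma>" \<delta> \<gamma> by (rule opposite)
  let ?h = "\<lambda>x. (norm (f x))\<^sup>2 * jacobi_weight \<alpha> \<beta> x"
  have c: "continuous_on {-1<..<1} f" by (rule smooth_continuous_on[OF assms(1)])
  then have ch: "continuous_on {-1<..<1} ?h"
    by (intro continuous_intros continuous_on_jacobi_weight)
  obtain e C where e: "e > 0"
    "\<forall>x\<in>{-1<..<1}. 1 - \<sigma> * x < e \<longrightarrow> \<bar>?h x\<bar> \<le> C * (1 - \<sigma> * x) powr (-\<gamma>)"
    using end_form_bound[OF assms(2)] by blast
  obtain d B where d: "d > 0"
    "\<forall>x\<in>{-1<..<1}. 1 - (-\<sigma>) * x < d \<longrightarrow> \<bar>?h x\<bar> \<le> B * (1 - (-\<sigma>) * x) powr (-\<delta>)"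
    using opp.end_form_bound[OF assms(3)] by blast
  \<comment> \<open>The sign \<sigma> decides which of the two bounds belongs to the endpoint
    1.\<close>
  have "set_integrable lebesgue {-1<..<1} ?h"
  proof (cases "\<sigma> = 1")
    case True
    show ?thesis
      by (rule set_integrable_endpoint_bounds[OF ch exponents(2,4) e(1) _ d(1)])
        (use e(2) d(2) True in auto)
  next
    case False
    then have "\<sigma> = -1" using sign by blast
    then show ?thesis
      by (intro set_integrable_endpoint_bounds[OF ch exponents(4,2) d(1) _ e(1)])
        (use e(2) d(2) in auto)
  qed
  then show ?thesis
    using set_borel_measurable_open_continuous[OF c] by (simp add: L2_jacobi_def)
qed

lemma jacobi_power_in_L2:
  assumes "smooth_on_interval f" "end_form \<sigma> \<gamma> f P Q" "end_form (-\<sigma>) \<delta> f P' Q'"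
  shows "jacobi_power \<alpha> \<beta> k f \<in> L2_jacobi \<alpha> \<beta>"
proof -
  interpret opp: jacobi_endpoint \<alpha> \<beta> "-\<sigma>" \<delta> \<gamma> by (rule opposite)
  show ?thesis
    by (rule smooth_end_forms_in_L2[OF smooth_jacobi_power end_form_jacobi_power
        opp.end_form_jacobi_power]) (rule assms)+
qed

lemma smooth_end_forms_in_D_max:
  assumes "smooth_on_interval f" "end_form \<sigma> \<gamma> f P Q" "end_form (-\<sigma>) \<delta> f P' Q'"
  shows "f \<in> D_max \<alpha> \<beta> n"
  using smooth_end_forms_in_L2[OF assms] jacobi_power_in_L2[OF assms] assms(1)
    smooth_imp_AC_loc[OF smooth_deriv_iter[OF assms(1)]]
  by (simp add: D_max_def smooth_on_interval_def)

text \<open>Since g vanishes near the other end, all Wronskians have limit 0 there. At \<sigma> the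
  boundary values enter the integral with sign \<sigma>, which cancels the \<sigma> from
  \<open>tendsto_wronskian\<close>.\<close>

lemma sesqui_form_one_end:
  assumes f: "smooth_on_interval f" "end_form \<sigma> \<gamma> f P Q" "end_form (-\<sigma>) \<delta> f P' Q'"
    and g: "smooth_on_interval g" "end_form \<sigma> \<gamma> g R S" "end_form (-\<sigma>) \<delta> g 0 0"
  shows "sesqui_form \<alpha> \<beta> n f g = of_real (\<gamma> * 2 powr (\<delta> + 1)) *
    ((\<Sum>k<n. coeff ((jacobi_end_poly \<gamma> \<delta> 0 ^^ (n - 1 - k)) P) 0 *
        cnj (coeff ((jacobi_end_poly \<gamma> \<delta> \<gamma> ^^ k) S) 0)) -
     (\<Sum>k<n. coeff ((jacobi_end_poly \<gamma> \<delta> \<gamma> ^^ (n - 1 - k)) Q) 0 *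
        cnj (coeff ((jacobi_end_poly \<gamma> \<delta> 0 ^^ k) R) 0)))"
proof -
  interpret opp: jacobi_endpoint \<alpha> \<beta> "-\<sigma>" \<delta> \<gamma> by (rule opposite)
  let ?l = "jacobi_power \<alpha> \<beta>"
  define L where "L k = of_real (\<sigma> * \<gamma> * 2 powr (\<delta> + 1)) *
    (coeff ((jacobi_end_poly \<gamma> \<delta> 0 ^^ (n - 1 - k)) P) 0 * cnj (coeff ((jacobi_end_poly \<gamma> \<delta> \<gamma> ^^ k) S) 0) -
     coeff ((jacobi_end_poly \<gamma> \<delta> \<gamma> ^^ (n - 1 - k)) Q) 0 * cnj (coeff ((jacobi_end_poly \<gamma> \<delta> 0 ^^ k) R) 0))" for k
  have lim: "(wronskian \<alpha> \<beta> (?l (n - 1 - k) f) (?l k g) \<longlongrightarrow> L k) (at \<sigma> within {-1<..<1})" for k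
    unfolding L_def
    by (intro tendsto_wronskian end_form_jacobi_power f(1,2) g(1,2))
  have lim': "(wronskian \<alpha> \<beta> (?l (n - 1 - k) f) (?l k g) \<longlongrightarrow> 0) (at (-\<sigma>) within {-1<..<1})" for k
    using opp.tendsto_wronskian[OF opp.end_form_jacobi_power[OF f(1,3), of "n - 1 - k"]
        opp.end_form_jacobi_power[OF g(1,3), of k]]
    by (simp add: jacobi_end_poly_0)
  note boundary = sesqui_form_eq_boundary_values[OF f(1) smooth_end_forms_in_L2[OF f] jacobi_power_in_L2[OF f]
      g(1) smooth_end_forms_in_L2[OF g] jacobi_power_in_L2[OF g]]
  have "sesqui_form \<alpha> \<beta> n f g = of_real \<sigma> * (\<Sum>k<n. L k)"
  proof (cases "\<sigma> = 1")
    case True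
    then show ?thesis
      using boundary[of n "\<lambda>_. 0" L] lim lim' by simp
  next
    case False
    then have "\<sigma> = -1" using sign by blast
    then show ?thesis
      using boundary[of n L "\<lambda>_. 0"] lim lim' by simp
  qed
  also have "\<dots> = of_real (\<sigma> * \<sigma>) * of_real (\<gamma> * 2 powr (\<delta> + 1)) *
    ((\<Sum>k<n. coeff ((jacobi_end_poly \<gamma> \<delta> 0 ^^ (n - 1 - k)) P) 0 *
        cnj (coeff ((jacobi_end_poly \<gamma> \<delta> \<gamma> ^^ k) S) 0)) -
     (\<Sum>k<n. coeff ((jacobi_end_poly \<gamma> \<delta> \<gamma> ^^ (n - 1 - k)) Q) 0 *
        cnj (coeff ((jacobi_end_poly \<gamma> \<delta> 0 ^^ k) R) 0)))"
    by (simp add: L_def sum_distrib_left right_diff_distrib sum_subtractf mult_ac)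
  finally show ?thesis by (simp add: sign_square)
qed

section \<open>End coefficients of functions in the minimal domain\<close>

text \<open>Testing against \<open>\<phi> i\<close> keeps only the sum in Q, as the second
  polynomial of \<open>\<phi> i\<close> is zero; testing against \<open>\<psi> i\<close> keeps only
  the sum in P. By \<open>jacobi_end_poly_pairing\<close> each sum is a nonzero multiple of the
  coefficient of index j.\<close>

lemma D_min_end_coeffs_zero:
  assumes F: "smooth_on_interval F" "end_form \<sigma> \<gamma> F P Q" "end_form (-\<sigma>) \<delta> F P' Q'"
    and min: "F \<in> D_min \<alpha> \<beta> n"
    and \<phi>: "\<And>j. smooth_on_interval (\<phi> j)" "\<And>j. end_form \<sigma> \<gamma> (\<phi> j) (monom 1 j) 0"
      "\<And>j. end_form (-\<sigma>) \<delta> (\<phi> j) 0 0"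
    and \<psi>: "\<And>j. smooth_on_interval (\<psi> j)" "\<And>j. end_form \<sigma> \<gamma> (\<psi> j) 0 (monom 1 j)"
      "\<And>j. end_form (-\<sigma>) \<delta> (\<psi> j) 0 0"
  shows "j < n \<Longrightarrow> coeff P j = 0 \<and> coeff Q j = 0"
proof (induction j rule: less_induct)
  case (less j)
  then have low: "\<forall>m<j. coeff P m = 0" "\<forall>m<j. coeff Q m = 0" by auto
  define i where "i = n - 1 - j"
  \<comment> \<open>These are the factors m + 1 + \<gamma> and m + 1 - \<gamma>, nonzero since 0 <
    \<gamma> < 1.\<close>
  have c: "real (Suc m) + \<gamma> - 2 * 0 \<noteq> 0" "real (Suc m) + \<gamma> - 2 * \<gamma> \<noteq> 0" for m
    using exponents by auto
  have "sesqui_form \<alpha> \<beta> n F (\<phi> i) = 0" "sesqui_form \<alpha> \<beta> n F (\<psi> i) = 0"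
    using min smooth_end_forms_in_D_max[OF \<phi>] smooth_end_forms_in_D_max[OF \<psi>]
    by (auto simp: D_min_def)
  then have "(\<Sum>k<n. coeff ((jacobi_end_poly \<gamma> \<delta> \<gamma> ^^ (n - 1 - k)) Q) 0 *
        cnj (coeff ((jacobi_end_poly \<gamma> \<delta> 0 ^^ k) (monom 1 i)) 0)) = 0"
    "(\<Sum>k<n. coeff ((jacobi_end_poly \<gamma> \<delta> 0 ^^ (n - 1 - k)) P) 0 *
        cnj (coeff ((jacobi_end_poly \<gamma> \<delta> \<gamma> ^^ k) (monom 1 i)) 0)) = 0"
    unfolding sesqui_form_one_end[OF F \<phi>] sesqui_form_one_end[OF F \<psi>]
    using exponents by (simp_all add: jacobi_end_poly_0)
  \<comment> \<open>The exponents change roles: P is iterated with 0 and its test monomial with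
    \<gamma>, while Q is iterated with \<gamma> and its test monomial with 0.\<close>
  then show ?case
    using jacobi_end_poly_pairing[OF low(1) less.prems c(2) c(1), of \<delta>]
      jacobi_end_poly_pairing[OF low(2) less.prems c(1) c(2), of \<delta>]
    unfolding i_def by auto
qed

end

section \<open>The boundary functions and their independence\<close>

text \<open>The form \<open>1 - 1 * x\<close>, like \<open>1 - (-1) * x\<close> in the next lemma,
  matches the distance \<open>1 - \<sigma> * x\<close> in the end forms.\<close>

lemma eventually_at_left_one_imp_ball:
  assumes "\<forall>\<^sub>F x in at_left (1::real). P x"
  shows "\<exists>e>0. \<forall>x\<in>{-1<..<1}. 1 - 1 * x < e \<longrightarrow> P x"
proof -
  obtain b where "b < 1" "\<forall>y>b. y < 1 \<longrightarrow> P y"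
    using assms unfolding eventually_at_left_field by blast
  then show ?thesis by (intro exI[of _ "1 - b"]) auto
qed

lemma eventually_at_right_minus_one_imp_ball:
  assumes "\<forall>\<^sub>F x in at_right (-1::real). P x"
  shows "\<exists>e>0. \<forall>x\<in>{-1<..<1}. 1 - (-1) * x < e \<longrightarrow> P x"
proof -
  obtain b where "b > -1" "\<forall>y>-1. y < b \<longrightarrow> P y"
    using assms unfolding eventually_at_right_field by blast
  then show ?thesis by (intro exI[of _ "b + 1"]) auto
qed

lemma end_form_powr_nat:
  assumes "\<sigma> = 1 \<or> \<sigma> = -1"
    and "\<exists>e>0. \<forall>x\<in>{-1<..<1}. 1 - \<sigma> * x < e \<longrightarrow> f x = of_real ((1 - \<sigma> * x) powr real j)"
  shows "end_form \<sigma> \<gamma> f (monom 1 j) 0"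
proof -
  have "complex_of_real ((1 - \<sigma> * x) powr real j) = end_term \<sigma> 0 (monom 1 j) x + end_term \<sigma> \<gamma> 0 x"
    if "x \<in> {-1<..<1}" for x
  proof -
    have "1 - \<sigma> * x > 0" using assms(1) that by auto
    then show ?thesis by (simp add: end_term_def poly_monom powr_realpow del: of_real_diff)
  qed
  then show ?thesis using assms(2) unfolding end_form_def by metis
qed

lemma end_form_powr_shifted:
  assumes "\<sigma> = 1 \<or> \<sigma> = -1"
    and "\<exists>e>0. \<forall>x\<in>{-1<..<1}. 1 - \<sigma> * x < e \<longrightarrow> f x = of_real ((1 - \<sigma> * x) powr (-\<gamma> + real j))"
  shows "end_form \<sigma> \<gamma> f 0 (monom 1 j)"
proof -
  have "complex_of_real ((1 - \<sigma> * x) powr (-\<gamma> + real j)) = end_term \<sigma> 0 0 x + end_term \<sigma> \<gamma> (monom 1 j) x"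
    if "x \<in> {-1<..<1}" for x
  proof -
    have "1 - \<sigma> * x > 0" using assms(1) that by auto
    then show ?thesis by (simp add: end_term_def poly_monom powr_add powr_realpow del: of_real_diff add_uminus_conv_diff uminus_add_conv_diff)
  qed
  then show ?thesis using assms(2) unfolding end_form_def by metis
qed

text \<open>The exponent r is left open so that one lemma serves both families: \<phi> receives the
  pair (t^j, 0) and \<psi> the pair (0, t^j) at 1, and both receive the zero pair at -1.\<close>

lemma boundary_fun_plus_end_forms:
  assumes "boundary_fun_plus r f"
  shows "smooth_on_interval f" "end_form (-1) \<delta> f 0 0"
    "r = real j \<Longrightarrow> end_form 1 \<gamma> f (monom 1 j) 0"
    "r = -\<gamma> + real j \<Longrightarrow> end_form 1 \<gamma> f 0 (monom 1 j)"
proof -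
  show "smooth_on_interval f" "end_form (-1) \<delta> f 0 0"
    using assms eventually_at_right_minus_one_imp_ball[of "\<lambda>x. f x = 0"]
    unfolding end_form_zero boundary_fun_plus_def by simp_all
  have "\<exists>e>0. \<forall>x\<in>{-1<..<1}. 1 - 1 * x < e \<longrightarrow> f x = of_real ((1 - 1 * x) powr r)"
    by (rule eventually_at_left_one_imp_ball) (use assms in \<open>simp add: boundary_fun_plus_def\<close>)
  then show "r = real j \<Longrightarrow> end_form 1 \<gamma> f (monom 1 j) 0"
    "r = -\<gamma> + real j \<Longrightarrow> end_form 1 \<gamma> f 0 (monom 1 j)"
    by (simp_all only: end_form_powr_nat end_form_powr_shifted simp_thms)
qed

lemma boundary_fun_minus_end_forms:
  assumes "boundary_fun_minus r f"
  shows "smooth_on_interval f" "end_form 1 \<gamma> f 0 0"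
    "r = real j \<Longrightarrow> end_form (-1) \<delta> f (monom 1 j) 0"
    "r = -\<delta> + real j \<Longrightarrow> end_form (-1) \<delta> f 0 (monom 1 j)"
proof -
  show "smooth_on_interval f" "end_form 1 \<gamma> f 0 0"
    using assms eventually_at_left_one_imp_ball[of "\<lambda>x. f x = 0"]
    unfolding end_form_zero boundary_fun_minus_def by simp_all
  have "\<exists>e>0. \<forall>x\<in>{-1<..<1}. 1 - (-1) * x < e \<longrightarrow> f x = of_real ((1 - (-1) * x) powr r)"
    by (rule eventually_at_right_minus_one_imp_ball) (use assms in \<open>simp add: boundary_fun_minus_def\<close>)
  then show "r = real j \<Longrightarrow> end_form (-1) \<delta> f (monom 1 j) 0"
    "r = -\<delta> + real j \<Longrightarrow> end_form (-1) \<delta> f 0 (monom 1 j)"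
    by (simp_all only: end_form_powr_nat end_form_powr_shifted simp_thms)
qed

text \<open>This splits a linear combination of the basis into its four blocks of length n.\<close>

lemma sum_lessThan_mult4:
  fixes f :: "nat \<Rightarrow> 'a::comm_monoid_add"
  shows "(\<Sum>i<4 * n. f i) = (\<Sum>j<n. f j + f (n + j) + f (2 * n + j) + f (3 * n + j))"
proof -
  have split: "(\<Sum>i<m + n. f i) = (\<Sum>i<m. f i) + (\<Sum>j<n. f (m + j))" for m
    by (induction n) (simp_all add: add.assoc)
  have "4 * n = ((n + n) + n) + n" "2 * n = n + n" "3 * n = n + n + n" by simp_all
  then show ?thesis by (simp only: split sum.distrib)
qed

lemma coeff_sum_monom: "j < n \<Longrightarrow> coeff (\<Sum>i<n. monom (a i) i) j = a j"
  by (simp add: coeff_sum)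

text \<open>The end forms of a combination in the minimal domain show its coefficients: those of the
  plus functions at 1 and those of the minus functions at -1.\<close>

theorem theorem4p7:
  fixes \<alpha> \<beta> :: real and n :: nat
    and \<phi>p \<phi>m \<psi>p \<psi>m :: "nat \<Rightarrow> real \<Rightarrow> complex"
  assumes "0 < \<alpha>" "\<alpha> < 1" "0 < \<beta>" "\<beta> < 1" and "n \<ge> 1"
    and "\<And>j. boundary_fun_plus (real j) (\<phi>p j)"
    and "\<And>j. boundary_fun_minus (real j) (\<phi>m j)"
    and "\<And>j. boundary_fun_plus (- \<alpha> + real j) (\<psi>p j)"
    and "\<And>j. boundary_fun_minus (- \<beta> + real j) (\<psi>m j)"
  shows "lin_indep_mod (D_min \<alpha> \<beta> n) (boundary_basis n \<phi>m \<psi>m @ boundary_basis n \<phi>p \<psi>p)"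
proof -
  interpret p: jacobi_endpoint \<alpha> \<beta> 1 \<alpha> \<beta> by unfold_locales (use assms in auto)
  interpret m: jacobi_endpoint \<alpha> \<beta> "-1" \<beta> \<alpha> by unfold_locales (use assms in auto)
  note php = boundary_fun_plus_end_forms[OF assms(6)]
  note psp = boundary_fun_plus_end_forms[OF assms(8)]
  note phm = boundary_fun_minus_end_forms[OF assms(7)]
  note psm = boundary_fun_minus_end_forms[OF assms(9)]
  let ?fs = "boundary_basis n \<phi>m \<psi>m @ boundary_basis n \<phi>p \<psi>p"
  have len: "length ?fs = 4 * n" by (simp add: boundary_basis_def)
  have nth: "?fs ! j = \<phi>m j" "?fs ! (n + j) = \<psi>m j" "?fs ! (2 * n + j) = \<phi>p j" "?fs ! (3 * n + j) = \<psi>p j"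
    if "j < n" for j
    using that by (simp_all add: boundary_basis_def nth_append)
  show ?thesis
    unfolding lin_indep_mod_def len
  proof (intro allI impI)
    fix c :: "nat \<Rightarrow> complex" and i
    assume min: "(\<lambda>x. \<Sum>i<4 * n. c i * (?fs ! i) x) \<in> D_min \<alpha> \<beta> n" and i: "i < 4 * n"
    define F where "F = (\<lambda>x. \<Sum>j<n. c j * \<phi>m j x + c (n + j) * \<psi>m j x +
      c (2 * n + j) * \<phi>p j x + c (3 * n + j) * \<psi>p j x)"
    have "(\<lambda>x. \<Sum>i<4 * n. c i * (?fs ! i) x) = F"
      unfolding F_def sum_lessThan_mult4 by (intro ext sum.cong) (simp_all add: nth)
    with min have F_min: "F \<in> D_min \<alpha> \<beta> n" by simp
    have F_smooth: "smooth_on_interval F"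
      unfolding F_def by (intro smooth_sum smooth_add smooth_cmult php(1) psp(1) phm(1) psm(1)) simp
    \<comment> \<open>The minus functions vanish near 1, so their coefficients multiply the zero
      polynomial.\<close>
    have Fp: "end_form 1 \<alpha> F (\<Sum>j<n. monom (c (2 * n + j)) j) (\<Sum>j<n. monom (c (3 * n + j)) j)"
    proof -
      have "end_form 1 \<alpha> F
        (\<Sum>j<n. smult (c j) 0 + smult (c (n + j)) 0 + smult (c (2 * n + j)) (monom 1 j) + smult (c (3 * n + j)) 0)
        (\<Sum>j<n. smult (c j) 0 + smult (c (n + j)) 0 + smult (c (2 * n + j)) 0 + smult (c (3 * n + j)) (monom 1 j))"
        unfolding F_def
        by (intro end_form_sum end_form_add end_form_cmult php(3) psp(4) phm(2) psm(2)) simp_all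
      then show ?thesis by (simp add: smult_monom)
    qed
    have Fm: "end_form (-1) \<beta> F (\<Sum>j<n. monom (c j) j) (\<Sum>j<n. monom (c (n + j)) j)"
    proof -
      have "end_form (-1) \<beta> F
        (\<Sum>j<n. smult (c j) (monom 1 j) + smult (c (n + j)) 0 + smult (c (2 * n + j)) 0 + smult (c (3 * n + j)) 0)
        (\<Sum>j<n. smult (c j) 0 + smult (c (n + j)) (monom 1 j) + smult (c (2 * n + j)) 0 + smult (c (3 * n + j)) 0)"
        unfolding F_def
        by (intro end_form_sum end_form_add end_form_cmult php(2) psp(2) phm(3) psm(4)) simp_all
      then show ?thesis by (simp add: smult_monom)
    qed
    have zp: "c (2 * n + j) = 0 \<and> c (3 * n + j) = 0" if "j < n" for j
      using p.D_min_end_coeffs_zero[OF F_smooth Fp Fm F_min php(1) php(3)[OF refl] php(2)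
          psp(1) psp(4)[OF refl] psp(2) that]
      by (simp add: coeff_sum_monom[OF that])
    \<comment> \<open>In this interpretation the other end appears as \<open>- (-1)\<close>; the
      premises left as \<open>_\<close> concern that end and are matched after
      simplification.\<close>
    have zm: "c j = 0 \<and> c (n + j) = 0" if "j < n" for j
      using m.D_min_end_coeffs_zero[of F _ _ _ _ n \<phi>m \<psi>m j, OF F_smooth Fm _ F_min phm(1) phm(3)[OF refl] _
          psm(1) psm(4)[OF refl] _ that] Fp phm(2) psm(2)
      by (simp add: coeff_sum_monom[OF that])
    consider "i < n" | j where "j < n" "i = n + j" | j where "j < n" "i = 2 * n + j" | j where "j < n" "i = 3 * n + j"
    proof -
      have "i < n \<or> (i - n < n \<and> i = n + (i - n)) \<or> (i - 2 * n < n \<and> i = 2 * n + (i - 2 * n)) \<or>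
        (i - 3 * n < n \<and> i = 3 * n + (i - 3 * n))"
        using i by linarith
      then show ?thesis using that by blast
    qed
    then show "c i = 0" using zp zm by cases auto
  qed
qed

end
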